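(* Let the coding system be any one of $\mathsf{K}_1$, $\mathsf{K}_2$, $\mathsf{KV}$. Then $\mathsf{BddSeq}_\omega$ is complete with respect to $\Sigma^0_2$ subobjects of $\omega^\omega$ having the increasing witness property; that is, $\mathsf{BddSeq}_\omega$ is a $\Sigma^0_2$ subobject of $\omega^\omega$ having the increasing witness property, and every $\Sigma^0_2$ subobject $A$ of $\omega^\omega$ having the increasing witness property satisfies $A\leq_{\sf m}\mathsf{BddSeq}_\omega$.
   Context: Coding systems. $\mathsf{K}_1$: $\mathtt{Code}=\omega$, and the (partial) realizable functions are the partial computable functions on $\omega$. $\mathsf{K}_2$: $\mathtt{Code}=\omega^\omega$, and the realizable functions are the partial continuous functions $x\mapsto p\ast x$ ($p\in\omega^\omega$), where $\ast$ is application in Kleene's second algebra. $\mathsf{KV}$: $\mathtt{Code}=\omega^\omega$ with the same application, and the realizable functions are the partial computable ones (those $x\mapsto p\ast x$ with $p$ computable). Fix one of them; $\langle\cdot,\cdot\rangle$ is a standard computable tupling on $\mathtt{Code}$. A represented space $X$ is a set $|X|$ with a partial surjection $\delta_X$ from $\mathtt{Code}$ onto $|X|$; $p$ is an $X$-name of $x$ if $\delta_X(p)=x$. A morphism $f\colon X\to Y$ is a function $|X|\to|Y|$ for which some partial realizable function sends every $X$-name of $x$ to a $Y$-name of $f(x)$. Names of elements of finite products are tuples of names. In $\mathsf{K}_1$, $n\in\omega$ has name $n$, and $\omega^\omega$ consists of the total computable functions, a name being any index; in $\mathsf{K}_2,\mathsf{KV}$, $n\in\omega$ has name $n0^\infty$,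 and $\omega^\omega$ consists of all functions, each named by itself. A subobject $A$ of $X$ is a represented space with $|A|\subseteq|X|$ such that some partial realizable function sends every $A$-name of $x\in|A|$ to an $X$-name of $x$. It is a subspace if moreover $A$-names and $X$-names of each $x\in|A|$ coincide. For subobjects $A,B$ of $X$, $A\subseteq B$ means $|A|\subseteq|B|$ and the inclusion $A\to B$ is a morphism; $A\equiv B$ means $A\subseteq B$ and $B\subseteq A$. Many-one reducibility: for subobjects $A$ of $X$ and $B$ of $Y$, $A\leq_{\sf m}B$ if there are a morphism $\varphi\colon X\to Y$ and partial realizable functions $r_-,r_+$ with: (1) for all $x\in|X|$, $x\in|A|\iff\varphi(x)\in|B|$; (2) if $p$ is an $A$-name of $x\in|A|$ then $r_-(p)$ is a $B$-name of $\varphi(x)$; (3) if $p$ is an $X$-name of $x\in|A|$ and $q$ is a $B$-name of $\varphi(x)$ then $r_+(p,q)$ is an $A$-name of $x$. A uniformly $\Pi^0_1$ sequence of subobjects of $\omega^\omega$ is a sequence $(B_n)_{n\in\omega}$ for which there is a morphism $f\colon\omega\times\omega^\omega\times\omega\to\omega$ such that $B_n$ is (equivalent, uniformly in $n$, to) the subspace $\{x:\forall k\; f(n,x,k)=0\}$. The witnessed union $\biguplus_nB_n$ has underlying set $\bigcup_n|B_n|$, and $\langle u,p\rangle$ is a name of $x$ in it iff $u$ is a name of some $n\in\omega$ and $p$ is a name of $x\in B_n$. A subobject $A$ of $\omega^\omega$ is $\Sigma^0_2$ if $A\equiv\biguplus_nB_n$ for some uniformly $\Pi^0_1$ sequence $(B_n)$.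 It has the increasing witness property if such a sequence can be chosen with $|B_n|\subseteq|B_m|$ whenever $n\leq m$. $\mathsf{BddSeq}_\omega$ is the subobject of $\omega^\omega$ with $|\mathsf{BddSeq}_\omega|=\{x:\exists b\,\forall n\; x(n)\leq b\}$; a name of $x\in\mathsf{BddSeq}_\omega$ is a pair $\langle b,p\rangle$ with $p$ an $\omega^\omega$-name of $x$ and $x(n)\leq b$ for all $n$. *)

theory Defs
  imports Main "HOL-Library.Nat_Bijection"
begin

section \<open>Partial computable functions\<close>

text \<open>
  Partial recursive functions on the natural numbers. Programs are unary; several arguments are
  passed through the Cantor pairing \<^const>\<open>prod_encode\<close>.
\<close>

datatype prog =
    PZero
  | PSucc
  | PFst
  | PSnd
  | PPair prog prog
  | PComp prog prog
  | PRec prog prog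
  | PMu prog

text \<open>
  Values \<open>None\<close> stand for divergence. With \<open>\<langle>_,_\<rangle>\<close> the Cantor pairing, \<open>h = PRec f g\<close> satisfies
  \<open>h \<langle>a,0\<rangle> = f a\<close> and \<open>h \<langle>a,m+1\<rangle> = g \<langle>a,\<langle>m,h \<langle>a,m\<rangle>\<rangle>\<rangle>\<close>. The value of \<open>PMu f\<close> at \<open>a\<close> is the least \<open>n\<close>
  with \<open>f \<langle>a,n\<rangle> = 0\<close>, all earlier values being required to converge.
\<close>

primrec run :: "prog \<Rightarrow> nat \<rightharpoonup> nat" where
  "run PZero = (\<lambda>x. Some 0)"
| "run PSucc = (\<lambda>x. Some (Suc x))"
| "run PFst = (\<lambda>x. Some (fst (prod_decode x)))"
| "run PSnd = (\<lambda>x. Some (snd (prod_decode x)))"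
| "run (PPair f g) =
    (\<lambda>x. Option.bind (run f x) (\<lambda>y. Option.bind (run g x) (\<lambda>z. Some (prod_encode (y, z)))))"
| "run (PComp f g) = (\<lambda>x. Option.bind (run g x) (run f))"
| "run (PRec f g) =
    (\<lambda>x. case prod_decode x of (a, n) \<Rightarrow>
      rec_nat (run f a)
        (\<lambda>m r. Option.bind r (\<lambda>y. run g (prod_encode (a, prod_encode (m, y))))) n)"
| "run (PMu f) =
    (\<lambda>a. let P = (\<lambda>n. run f (prod_encode (a, n)) = Some 0 \<and>
                       (\<forall>m<n. run f (prod_encode (a, m)) \<noteq> None))
         in if \<exists>n. P n then Some (LEAST n. P n) else None)"

lemma prod_decode_le:
  "fst (prod_decode m) \<le> m" "snd (prod_decode m) \<le> m"
  by (metis le_prod_encode_1 le_prod_encode_2 prod.collapse prod_decode_inverse)+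

text \<open>The Goedel numbering of programs; it is a bijection between numbers and programs.\<close>

function decode_prog :: "nat \<Rightarrow> prog" where
  "decode_prog e =
    (if e = 0 then PZero
     else if e = 1 then PSucc
     else if e = 2 then PFst
     else if e = 3 then PSnd
     else
       let m = (e - 4) div 4; a = fst (prod_decode m); b = snd (prod_decode m); t = (e - 4) mod 4
       in if t = 0 then PPair (decode_prog a) (decode_prog b)
          else if t = 1 then PComp (decode_prog a) (decode_prog b)
          else if t = 2 then PRec (decode_prog a) (decode_prog b)
          else PMu (decode_prog m))"
  by pat_completeness auto

termination
proof -
  have "m div 4 < e" if "m = e - 4" "e \<noteq> 0" for m e :: nat
    using that by linarith
  then show ?thesis
    by (relation "measure (\<lambda>e. e)")
      (auto intro: le_less_trans[OF prod_decode_le(1)] le_less_trans[OF prod_decode_le(2)])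
qed

declare decode_prog.simps [simp del]

definition phi :: "nat \<Rightarrow> nat \<rightharpoonup> nat" where
  "phi e = run (decode_prog e)"

definition computable :: "(nat \<Rightarrow> nat) \<Rightarrow> bool" where
  "computable p \<longleftrightarrow> (\<exists>e. \<forall>n. phi e n = Some (p n))"


section \<open>Kleene's second algebra\<close>

text \<open>
  \<open>(p * x)(n)\<close> is \<open>p(\<langle>n, x(0), \<dots>, x(k-1)\<rangle>) - 1\<close> for the least \<open>k\<close> where this \<open>p\<close>-value is nonzero;
  \<open>p * x\<close> is defined iff such a \<open>k\<close> exists for every \<open>n\<close>.
\<close>

definition kquery :: "(nat \<Rightarrow> nat) \<Rightarrow> (nat \<Rightarrow> nat) \<Rightarrow> nat \<Rightarrow> nat \<Rightarrow> nat" where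
  "kquery p x n k = p (list_encode (n # map x [0..<k]))"

definition kapp :: "(nat \<Rightarrow> nat) \<Rightarrow> (nat \<Rightarrow> nat) \<rightharpoonup> (nat \<Rightarrow> nat)" where
  "kapp p x =
    (if \<forall>n. \<exists>k. kquery p x n k \<noteq> 0
     then Some (\<lambda>n. kquery p x n (LEAST k. kquery p x n k \<noteq> 0) - 1)
     else None)"

definition interleave :: "(nat \<Rightarrow> nat) \<times> (nat \<Rightarrow> nat) \<Rightarrow> nat \<Rightarrow> nat" where
  "interleave = (\<lambda>(x, y) n. if even n then x (n div 2) else y (n div 2))"

definition deinterleave :: "(nat \<Rightarrow> nat) \<Rightarrow> (nat \<Rightarrow> nat) \<times> (nat \<Rightarrow> nat)" where
  "deinterleave z = (\<lambda>n. z (2 * n), \<lambda>n. z (2 * n + 1))"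

lemma deinterleave_interleave: "deinterleave (interleave c) = c"
  by (cases c) (simp add: deinterleave_def interleave_def)

lemma interleave_deinterleave: "interleave (deinterleave z) = z"
  by (rule ext) (auto simp: deinterleave_def interleave_def elim: evenE oddE)


section \<open>Coding systems and represented spaces\<close>

text \<open>
  A represented space is its representation \<open>\<delta> :: 'c \<rightharpoonup> 'a\<close>; the underlying set is \<open>ran \<delta>\<close>, and
  \<open>\<delta> p = Some x\<close> says that \<open>p\<close> is a name of \<open>x\<close>.
\<close>

type_synonym ('c, 'a) rep_space = "'c \<rightharpoonup> 'a"

text \<open>
  In each of the systems below the pairing is a bijection \<open>'c \<times> 'c \<Rightarrow> 'c\<close> with inverse \<open>cunpair\<close>.
\<close>

record 'c coding_system =
  realizable :: "('c \<rightharpoonup> 'c) set"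
  cpair :: "'c \<times> 'c \<Rightarrow> 'c"
  cunpair :: "'c \<Rightarrow> 'c \<times> 'c"
  omega :: "('c, nat) rep_space"
  baire :: "('c, nat \<Rightarrow> nat) rep_space"

definition K1 :: "nat coding_system" where
  "K1 = \<lparr>
    realizable = range phi,
    cpair = prod_encode,
    cunpair = prod_decode,
    omega = (\<lambda>n. Some n),
    baire = (\<lambda>e. if \<forall>n. phi e n \<noteq> None then Some (\<lambda>n. the (phi e n)) else None)\<rparr>"

definition K2 :: "(nat \<Rightarrow> nat) coding_system" where
  "K2 = \<lparr>
    realizable = range kapp,
    cpair = interleave,
    cunpair = deinterleave,
    omega = (\<lambda>u. if \<forall>i>0. u i = 0 then Some (u 0) else None),
    baire = (\<lambda>x. Some x)\<rparr>"

definition KV :: "(nat \<Rightarrow> nat) coding_system" where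
  "KV = K2\<lparr>realizable := kapp ` {p. computable p}\<rparr>"

definition prod_space ::
  "'c coding_system \<Rightarrow> ('c, 'a) rep_space \<Rightarrow> ('c, 'b) rep_space \<Rightarrow> ('c, 'a \<times> 'b) rep_space" where
  "prod_space C X Y c =
    (case cunpair C c of (p, q) \<Rightarrow>
      Option.bind (X p) (\<lambda>x. Option.bind (Y q) (\<lambda>y. Some (x, y))))"

definition rep_subspace :: "('c, 'a) rep_space \<Rightarrow> 'a set \<Rightarrow> ('c, 'a) rep_space" where
  "rep_subspace X S p = Option.bind (X p) (\<lambda>x. if x \<in> S then Some x else None)"

text \<open>Only the restriction of \<open>f\<close> to the underlying set of \<open>X\<close> matters.\<close>

definition morphism ::
  "'c coding_system \<Rightarrow> ('c, 'a) rep_space \<Rightarrow> ('c, 'b) rep_space \<Rightarrow> ('a \<Rightarrow> 'b) \<Rightarrow> bool" where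
  "morphism C X Y f \<longleftrightarrow>
    f ` ran X \<subseteq> ran Y \<and>
    (\<exists>r\<in>realizable C. \<forall>p x. X p = Some x \<longrightarrow> (\<exists>q. r p = Some q \<and> Y q = Some (f x)))"

definition subobject ::
  "'c coding_system \<Rightarrow> ('c, 'a) rep_space \<Rightarrow> ('c, 'a) rep_space \<Rightarrow> bool" where
  "subobject C A X \<longleftrightarrow> ran A \<subseteq> ran X \<and> morphism C A X (\<lambda>x. x)"

definition sub_le ::
  "'c coding_system \<Rightarrow> ('c, 'a) rep_space \<Rightarrow> ('c, 'a) rep_space \<Rightarrow> bool" where
  "sub_le C A B \<longleftrightarrow> ran A \<subseteq> ran B \<and> morphism C A B (\<lambda>x. x)"

definition sub_equiv ::
  "'c coding_system \<Rightarrow> ('c, 'a) rep_space \<Rightarrow> ('c, 'a) rep_space \<Rightarrow> bool" where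
  "sub_equiv C A B \<longleftrightarrow> sub_le C A B \<and> sub_le C B A"

text \<open>\<open>many_one C A X B Y\<close>: the subobject \<open>A\<close> of \<open>X\<close> reduces to the subobject \<open>B\<close> of \<open>Y\<close>.\<close>

definition many_one ::
  "'c coding_system \<Rightarrow> ('c, 'a) rep_space \<Rightarrow> ('c, 'a) rep_space \<Rightarrow>
   ('c, 'b) rep_space \<Rightarrow> ('c, 'b) rep_space \<Rightarrow> bool" where
  "many_one C A X B Y \<longleftrightarrow>
    (\<exists>\<phi>. morphism C X Y \<phi> \<and>
      (\<forall>x\<in>ran X. x \<in> ran A \<longleftrightarrow> \<phi> x \<in> ran B) \<and>
      (\<exists>r\<in>realizable C. \<forall>p x. A p = Some x \<longrightarrow> (\<exists>q. r p = Some q \<and> B q = Some (\<phi> x))) \<and>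
      (\<exists>r\<in>realizable C. \<forall>p q x.
        X p = Some x \<and> x \<in> ran A \<and> B q = Some (\<phi> x) \<longrightarrow>
        (\<exists>p'. r (cpair C (p, q)) = Some p' \<and> A p' = Some x)))"


section \<open>The second level of the arithmetical hierarchy\<close>

text \<open>Inclusion and equivalence of sequences of subobjects, uniformly in (a name of) the index.\<close>

definition uniform_le ::
  "'c coding_system \<Rightarrow> (nat \<Rightarrow> ('c, 'a) rep_space) \<Rightarrow> (nat \<Rightarrow> ('c, 'a) rep_space) \<Rightarrow> bool" where
  "uniform_le C A B \<longleftrightarrow>
    (\<exists>r\<in>realizable C. \<forall>n u p x.
      omega C u = Some n \<and> A n p = Some x \<longrightarrow>
      (\<exists>q. r (cpair C (u, p)) = Some q \<and> B n q = Some x))"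

definition uniform_equiv ::
  "'c coding_system \<Rightarrow> (nat \<Rightarrow> ('c, 'a) rep_space) \<Rightarrow> (nat \<Rightarrow> ('c, 'a) rep_space) \<Rightarrow> bool" where
  "uniform_equiv C A B \<longleftrightarrow> uniform_le C A B \<and> uniform_le C B A"

definition uniformly_Pi1 ::
  "'c coding_system \<Rightarrow> (nat \<Rightarrow> ('c, nat \<Rightarrow> nat) rep_space) \<Rightarrow> bool" where
  "uniformly_Pi1 C B \<longleftrightarrow>
    (\<forall>n. subobject C (B n) (baire C)) \<and>
    (\<exists>f. morphism C (prod_space C (omega C) (prod_space C (baire C) (omega C))) (omega C) f \<and>
      uniform_equiv C B (\<lambda>n. rep_subspace (baire C) {x. \<forall>k. f (n, x, k) = 0}))"

definition witnessed_union ::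
  "'c coding_system \<Rightarrow> (nat \<Rightarrow> ('c, 'a) rep_space) \<Rightarrow> ('c, 'a) rep_space" where
  "witnessed_union C B c =
    (case cunpair C c of (u, p) \<Rightarrow> Option.bind (omega C u) (\<lambda>n. B n p))"

definition Sigma2 :: "'c coding_system \<Rightarrow> ('c, nat \<Rightarrow> nat) rep_space \<Rightarrow> bool" where
  "Sigma2 C A \<longleftrightarrow>
    subobject C A (baire C) \<and>
    (\<exists>B. uniformly_Pi1 C B \<and> sub_equiv C A (witnessed_union C B))"

definition increasing_witness :: "'c coding_system \<Rightarrow> ('c, nat \<Rightarrow> nat) rep_space \<Rightarrow> bool" where
  "increasing_witness C A \<longleftrightarrow>
    (\<exists>B. uniformly_Pi1 C B \<and> sub_equiv C A (witnessed_union C B) \<and>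
      (\<forall>n m. n \<le> m \<longrightarrow> ran (B n) \<subseteq> ran (B m)))"

definition BddSeq :: "'c coding_system \<Rightarrow> ('c, nat \<Rightarrow> nat) rep_space" where
  "BddSeq C c =
    (case cunpair C c of (u, p) \<Rightarrow>
      Option.bind (omega C u) (\<lambda>b. Option.bind (baire C p)
        (\<lambda>x. if \<forall>n. x n \<le> b then Some x else None)))"

text \<open>Completeness among subobjects of \<open>\<omega>\<^sup>\<omega>\<close> with respect to a class \<open>P\<close> of such subobjects.\<close>

definition complete_for ::
  "'c coding_system \<Rightarrow> (('c, nat \<Rightarrow> nat) rep_space \<Rightarrow> bool) \<Rightarrow>
   ('c, nat \<Rightarrow> nat) rep_space \<Rightarrow> bool" where
  "complete_for C P S \<longleftrightarrow> P S \<and> (\<forall>A. P A \<longrightarrow> many_one C A (baire C) S (baire C))"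

end

theory Submission imports Defs
begin

text \<open>
  Membership of \<open>x\<close> in a \<open>\<Sigma>\<^sup>0\<^sub>2\<close> subobject is the existence of an \<open>n\<close> with \<open>f (n, x, k) = 0\<close> for
  all \<open>k\<close>. The reduction sends \<open>x\<close> to the sequence of its guesses at such a witness: at stage \<open>s\<close> the
  guess is the least \<open>n\<close> that has not been refuted by some \<open>k < s\<close>, cut off at \<open>s\<close> so that the search
  is finite. A true witness is never refuted, so it bounds all guesses (\<open>guess_le\<close>). Conversely, if
  the guesses stay below \<open>b\<close>, then the candidates up to \<open>b\<close> cannot all be refuted
  (\<open>bounded_guess\<close>), so some \<open>n \<le> b\<close> is a true witness. A bound alone does not tell which \<open>n\<close> it
  is, and this is where increasing witnesses enter: \<open>b\<close> itself is then a witness, and names can be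
  translated in both directions by passing the witness on as the bound and the bound as the witness.
  Hardness follows, and \<open>BddSeq\<close> belongs to the class because it is literally the witnessed union of
  the sets \<open>{x. \<forall>k. x k \<le> n}\<close>, which increase with \<open>n\<close>.

  This argument uses little of the coding system; the locale \<open>effective_coding\<close> collects what it
  needs. Besides closure under composition and pairing, these are: evaluation of \<open>x\<close> at \<open>k\<close>, currying
  of a morphism on \<open>\<omega> \<times> \<omega>\<^sup>\<omega> \<times> \<omega>\<close> to one from \<open>\<omega>\<^sup>\<omega>\<close> to \<open>\<omega>\<^sup>\<omega>\<close>, and operators on \<open>\<omega>\<^sup>\<omega>\<close> whose value at \<open>s\<close>
  depends computably on a prefix of computable length. The sequence of guesses is a
  curried morphism followed by such a prefix operator.

  For \<open>K1\<close>, evaluation amounts to a universal program, obtained by simulating programs on a stack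
  machine (\<open>universal_program\<close>), and currying to the s-m-n theorem (\<open>smn\<close>). For \<open>K2\<close> and \<open>KV\<close> the
  operators are given by explicit associates, that is, elements of Baire space acting by \<open>kapp\<close>. Each of
  them is computable relative to the associates it is built from, so one construction serves both
  systems (\<open>effective_coding_Kleene2\<close>).
\<close>

section \<open>Closure properties of the computable functions\<close>

abbreviation pfst :: "nat \<Rightarrow> nat" where "pfst z \<equiv> fst (prod_decode z)"
abbreviation psnd :: "nat \<Rightarrow> nat" where "psnd z \<equiv> snd (prod_decode z)"

fun encode_prog :: "prog \<Rightarrow> nat" where
  "encode_prog PZero = 0"
| "encode_prog PSucc = 1"
| "encode_prog PFst = 2"
| "encode_prog PSnd = 3"
| "encode_prog (PPair f g) = 4 + 4 * prod_encode (encode_prog f, encode_prog g)"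
| "encode_prog (PComp f g) = 5 + 4 * prod_encode (encode_prog f, encode_prog g)"
| "encode_prog (PRec f g) = 6 + 4 * prod_encode (encode_prog f, encode_prog g)"
| "encode_prog (PMu f) = 7 + 4 * encode_prog f"

lemma div_mod_4:
  "(4 * m) div 4 = (m::nat)" "Suc (4 * m) div 4 = m"
  "Suc (Suc (4 * m)) div 4 = m" "Suc (Suc (Suc (4 * m))) div 4 = m"
  "(4 * m) mod 4 = (0::nat)" "Suc (4 * m) mod 4 = 1"
  "Suc (Suc (4 * m)) mod 4 = 2" "Suc (Suc (Suc (4 * m))) mod 4 = 3"
  by presburger+

lemma decode_encode_prog [simp]: "decode_prog (encode_prog p) = p"
proof (induction p)
  case (PPair f g)
  then show ?case by (simp add: decode_prog.simps[of "4 + _"] div_mod_4 Let_def)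
next
  case (PComp f g)
  then show ?case by (simp add: decode_prog.simps[of "5 + _"] div_mod_4 Let_def)
next
  case (PRec f g)
  then show ?case by (simp add: decode_prog.simps[of "6 + _"] div_mod_4 Let_def)
next
  case (PMu f)
  then show ?case by (simp add: decode_prog.simps[of "7 + _"] div_mod_4 Let_def)
qed (simp_all add: decode_prog.simps)

lemma phi_encode_prog [simp]: "phi (encode_prog p) = run p"
  by (simp add: phi_def)

lemma computable_iff_run: "computable f \<longleftrightarrow> (\<exists>P. \<forall>n. run P n = Some (f n))"
  unfolding computable_def by (metis phi_def phi_encode_prog)

lemma computable_const: "computable (\<lambda>x. c)"
proof (induction c)
  case 0
  have "run PZero n = Some 0" for n by simp
  then show ?case unfolding computable_iff_run by blast
next
  case (Suc c)
  then obtain P where "\<forall>n. run P n = Some c" by (auto simp: computable_iff_run)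
  then have "\<forall>n. run (PComp PSucc P) n = Some (Suc c)" by simp
  then show ?case unfolding computable_iff_run by blast
qed

lemma computable_id: "computable (\<lambda>x. x)"
  unfolding computable_iff_run by (rule exI[of _ "PPair PFst PSnd"]) simp

lemma computable_compose:
  assumes "computable g" "computable f" shows "computable (\<lambda>x. g (f x))"
proof -
  obtain P Q where "\<forall>n. run P n = Some (g n)" "\<forall>n. run Q n = Some (f n)"
    using assms by (auto simp: computable_iff_run)
  then have "\<forall>n. run (PComp P Q) n = Some (g (f n))" by simp
  then show ?thesis unfolding computable_iff_run by blast
qed

lemma computable_basic: "computable Suc" "computable pfst" "computable psnd"
  unfolding computable_iff_run
  by (rule exI[of _ PSucc] exI[of _ PFst] exI[of _ PSnd], simp)+

lemma computable_Suc: "computable f \<Longrightarrow> computable (\<lambda>x. Suc (f x))"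
  by (rule computable_compose[OF computable_basic(1)])

lemma computable_pfst: "computable f \<Longrightarrow> computable (\<lambda>x. pfst (f x))"
  by (rule computable_compose[OF computable_basic(2)])

lemma computable_psnd: "computable f \<Longrightarrow> computable (\<lambda>x. psnd (f x))"
  by (rule computable_compose[OF computable_basic(3)])

lemma computable_prod_encode:
  assumes "computable f" "computable g" shows "computable (\<lambda>x. prod_encode (f x, g x))"
proof -
  obtain P Q where "\<forall>n. run P n = Some (f n)" "\<forall>n. run Q n = Some (g n)"
    using assms by (auto simp: computable_iff_run)
  then have "\<forall>n. run (PPair P Q) n = Some (prod_encode (f n, g n))" by simp
  then show ?thesis unfolding computable_iff_run by blast
qed

text \<open>
  The form in which a computable function of two arguments enters the rules below.
\<close>

lemma computable_compose2:
  assumes "computable (\<lambda>z. y (pfst z) (psnd z))" "computable f" "computable g"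
  shows "computable (\<lambda>x. y (f x) (g x))"
  using computable_compose[OF assms(1) computable_prod_encode[OF assms(2,3)]] by simp

text \<open>
  Closure properties are stated pointwise for functions of one number. A function with further
  arguments, such as \<open>g\<close> here, is required to be computable in the code of the tuple of its
  arguments; these rules can then be applied backwards along the structure of a term.
\<close>

lemma computable_rec:
  assumes f: "computable f"
    and g: "computable (\<lambda>z. g (pfst z) (pfst (psnd z)) (psnd (psnd z)))"
    and h: "computable h"
  shows "computable (\<lambda>x. rec_nat (f x) (\<lambda>m y. g x m y) (h x))"
proof -
  obtain P Q where P: "\<forall>n. run P n = Some (f n)"
    and Q: "\<forall>z. run Q z = Some (g (pfst z) (pfst (psnd z)) (psnd (psnd z)))"
    using f g by (auto simp: computable_iff_run)
  have rec: "run (PRec P Q) (prod_encode (a, n)) = Some (rec_nat (f a) (g a) n)" for a n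
    by (induction n) (simp_all add: P Q)
  have "run (PRec P Q) z = Some (rec_nat (f (pfst z)) (g (pfst z)) (psnd z))" for z
    using rec[of "pfst z" "psnd z"] by simp
  then have "computable (\<lambda>z. rec_nat (f (pfst z)) (g (pfst z)) (psnd z))"
    unfolding computable_iff_run by blast
  from computable_compose[OF this computable_prod_encode[OF computable_id h]]
  show ?thesis by simp
qed

lemmas computable_base = computable_const computable_id computable_Suc computable_pfst
  computable_psnd computable_prod_encode computable_rec

definition decidable :: "(nat \<Rightarrow> bool) \<Rightarrow> bool" where
  "decidable P \<longleftrightarrow> computable (\<lambda>x. of_bool (P x))"

text \<open>
  Definitions by recursion that reduce arithmetic and case distinction to \<open>computable_rec\<close>.
\<close>

lemma rec_nat_arith:
  "rec_nat a (\<lambda>m y. Suc y) b = a + b"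
  "rec_nat 0 (\<lambda>m y. m) b = b - 1"
  "rec_nat a (\<lambda>m y. y - 1) b = a - b"
  "rec_nat 0 (\<lambda>m y. y + a) b = a * b"
  "rec_nat u (\<lambda>m y. v) (of_bool P) = (if P then v else u)"
proof -
  show "rec_nat 0 (\<lambda>m y. m) b = b - 1" by (cases b) auto
qed (induction b; simp; fail | simp)+

lemma computable_add:
  assumes "computable f" "computable g" shows "computable (\<lambda>x. f x + g x)"
  unfolding rec_nat_arith(1)[symmetric] by (intro computable_base assms)

lemma computable_pred:
  assumes "computable f" shows "computable (\<lambda>x. f x - 1)"
  unfolding rec_nat_arith(2)[symmetric] by (intro computable_base assms)

lemma computable_diff:
  assumes "computable f" "computable g" shows "computable (\<lambda>x. f x - g x)"
proof -
  have "f x - g x = rec_nat (f x) (\<lambda>m y. y - 1) (g x)" for x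
    by (rule rec_nat_arith(3)[symmetric])
  then show ?thesis
    by (simp only:) (intro computable_base computable_pred assms)
qed

lemma computable_mult:
  assumes "computable f" "computable g" shows "computable (\<lambda>x. f x * g x)"
  unfolding rec_nat_arith(4)[symmetric]
  by (intro computable_base computable_add computable_compose[OF assms(1)] assms(2))

lemma computable_if:
  assumes "decidable P" "computable f" "computable g"
  shows "computable (\<lambda>x. if P x then f x else g x)"
  unfolding rec_nat_arith(5)[symmetric]
  by (intro computable_base computable_compose[OF assms(2)] assms(3)
      assms(1)[unfolded decidable_def])

lemma decidable_le:
  assumes "computable f" "computable g" shows "decidable (\<lambda>x. f x \<le> g x)"
proof -
  have "of_bool (f x \<le> g x) = 1 - (f x - g x)" for x by auto
  then show ?thesis unfolding decidable_def
    by (simp only:) (intro computable_base computable_diff assms)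
qed

lemma decidable_less:
  assumes "computable f" "computable g" shows "decidable (\<lambda>x. f x < g x)"
  using decidable_le[OF computable_Suc[OF assms(1)] assms(2)] by (simp add: Suc_le_eq)

lemma decidable_not: "decidable P \<Longrightarrow> decidable (\<lambda>x. \<not> P x)"
proof -
  assume P: "decidable P"
  have "of_bool (\<not> P x) = (1::nat) - of_bool (P x)" for x by simp
  then show ?thesis unfolding decidable_def
    by (simp only:) (intro computable_diff computable_const P[unfolded decidable_def])
qed

lemma decidable_conj: "decidable P \<Longrightarrow> decidable Q \<Longrightarrow> decidable (\<lambda>x. P x \<and> Q x)"
  unfolding decidable_def of_bool_conj by (rule computable_mult)

lemma decidable_eq:
  assumes "computable f" "computable g" shows "decidable (\<lambda>x. f x = g x)"
  using decidable_conj[OF decidable_le[OF assms] decidable_le[OF assms(2,1)]]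
  by (simp add: eq_iff)

text \<open>
  Bounded search keeps the bound as a default value, so that it is total and primitive recursive:
  the accumulator equals the stage \<open>m\<close> exactly as long as nothing below \<open>m\<close> has been found.
\<close>

lemma rec_nat_least:
  "rec_nat 0 (\<lambda>m y. if y = m \<and> \<not> P m then Suc m else y) b = (LEAST k. k = b \<or> P k)"
proof (induction b)
  case (Suc b)
  let ?L = "LEAST k. k = b \<or> P k"
  have L: "?L = b \<or> P ?L" "\<And>k. k < ?L \<Longrightarrow> \<not> (k = b \<or> P k)"
    by (rule LeastI[of "\<lambda>k. k = b \<or> P k" b], simp) (rule not_less_Least)
  have "?L \<le> b" by (rule Least_le) simp
  show ?case
  proof (cases "?L = b \<and> \<not> P b")
    case True
    have "(LEAST k. k = Suc b \<or> P k) = Suc b"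
    proof (rule Least_equality)
      fix k assume "k = Suc b \<or> P k"
      then show "Suc b \<le> k"
        using L(2)[of k] True by (cases k b rule: linorder_cases) auto
    qed simp
    then show ?thesis using True Suc by simp
  next
    case False
    have "(LEAST k. k = Suc b \<or> P k) = ?L"
    proof (rule Least_equality)
      show "?L = Suc b \<or> P ?L" using L(1) False by metis
      fix k assume "k = Suc b \<or> P k"
      then show "?L \<le> k" using L(2)[of k] \<open>?L \<le> b\<close> by (metis le_SucI leI)
    qed
    moreover have "rec_nat 0 (\<lambda>m y. if y = m \<and> \<not> P m then Suc m else y) (Suc b) = ?L"
      using False by (simp add: Suc)
    ultimately show ?thesis by simp
  qed
qed simp

lemma computable_least:
  assumes P: "decidable (\<lambda>z. P (pfst z) (psnd z))" and h: "computable h"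
  shows "computable (\<lambda>x. LEAST k. k = h x \<or> P x k)"
proof -
  have "decidable (\<lambda>z. P (pfst z) (pfst (psnd z)))"
    using computable_compose[OF P[unfolded decidable_def],
        of "\<lambda>z. prod_encode (pfst z, pfst (psnd z))"]
    by (simp add: decidable_def computable_base)
  then show ?thesis unfolding rec_nat_least[symmetric]
    by (intro computable_base computable_if decidable_conj decidable_eq decidable_not h)
qed

text \<open>
  A bounded universal statement holds iff the search for a counterexample returns its default.
\<close>

lemma decidable_all_less:
  assumes P: "decidable (\<lambda>z. P (pfst z) (psnd z))" and h: "computable h"
  shows "decidable (\<lambda>x. \<forall>k<h x. P x k)"
proof -
  have "(\<forall>k<h x. P x k) \<longleftrightarrow> (LEAST k. k = h x \<or> \<not> P x k) = h x" for x
  proof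
    assume "\<forall>k<h x. P x k"
    then show "(LEAST k. k = h x \<or> \<not> P x k) = h x"
      by (intro Least_equality) (auto intro: leI)
  next
    assume eq: "(LEAST k. k = h x \<or> \<not> P x k) = h x"
    show "\<forall>k<h x. P x k"
      using not_less_Least[of _ "\<lambda>k. k = h x \<or> \<not> P x k"] unfolding eq by blast
  qed
  then show ?thesis
    by (simp only:) (intro decidable_eq computable_least decidable_not assms)
qed

lemma div_least: "0 < c \<Longrightarrow> n div c = (LEAST k. k = n \<or> n < c * Suc k)" for n c :: nat
proof (rule Least_equality[symmetric])
  assume c: "0 < c"
  show "n div c = n \<or> n < c * Suc (n div c)"
    using c by (metis dividend_less_times_div mult_Suc_right add.commute)
  fix k assume "k = n \<or> n < c * Suc k"
  then show "n div c \<le> k"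
    using c by (metis div_le_dividend less_Suc_eq_le less_mult_imp_div_less mult.commute)
qed

lemma computable_div:
  assumes "computable f" "0 < c" shows "computable (\<lambda>x. f x div c)"
  unfolding div_least[OF assms(2)]
  by (intro computable_least decidable_less computable_compose[OF assms(1)] assms(1)
      computable_mult computable_base)

lemma computable_mod:
  assumes "computable f" "0 < c" shows "computable (\<lambda>x. f x mod c)"
  unfolding modulo_nat_def
  by (intro computable_diff computable_mult computable_div computable_const assms)

lemmas computable_rules = computable_const computable_id computable_Suc computable_pfst
  computable_psnd computable_prod_encode computable_rec computable_add computable_diff
  computable_mult computable_if computable_least computable_div computable_mod
  decidable_le decidable_less decidable_eq decidable_not decidable_conj
  decidable_all_less

section \<open>Lists coded as numbers\<close>

definition code_hd :: "nat \<Rightarrow> nat" where "code_hd c = pfst (c - 1)"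
definition code_tl :: "nat \<Rightarrow> nat" where "code_tl c = psnd (c - 1)"
definition code_drop :: "nat \<Rightarrow> nat \<Rightarrow> nat" where
  "code_drop i c = rec_nat c (\<lambda>_. code_tl) i"
definition code_nth :: "nat \<Rightarrow> nat \<Rightarrow> nat" where
  "code_nth c i = code_hd (code_drop i c)"

text \<open>
  A list is never longer than its code, so the length can be found by bounded search.
\<close>

definition code_length :: "nat \<Rightarrow> nat" where
  "code_length c = (LEAST i. i = c \<or> code_drop i c = 0)"

lemma code_hd_encode [simp]: "code_hd (list_encode (x # xs)) = x"
  and code_tl_encode [simp]: "code_tl (list_encode (x # xs)) = list_encode xs"
  by (simp_all add: code_hd_def code_tl_def)

lemma code_tl_Nil: "code_tl 0 = 0"
  by (metis code_tl_def diff_0_eq_0 le_zero_eq prod_decode_le(2))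

lemma code_drop_encode: "code_drop i (list_encode xs) = list_encode (drop i xs)"
proof (induction i)
  case (Suc i)
  have "code_tl (list_encode ys) = list_encode (tl ys)" for ys
    by (cases ys) (simp_all add: code_tl_Nil del: list_encode.simps(2))
  with Suc show ?case by (simp add: code_drop_def drop_Suc tl_drop)
qed (simp add: code_drop_def)

lemma code_nth_encode [simp]: "i < length xs \<Longrightarrow> code_nth (list_encode xs) i = xs ! i"
  by (simp add: code_nth_def code_drop_encode Cons_nth_drop_Suc[symmetric] del: list_encode.simps)

lemma length_le_list_encode: "length xs \<le> list_encode xs"
  by (induction xs) (auto intro: order_trans[OF _ le_prod_encode_2])

lemma code_length_encode [simp]: "code_length (list_encode xs) = length xs"
proof -
  have "list_encode ys = 0 \<longleftrightarrow> ys = []" for ys by (cases ys) auto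
  then show ?thesis unfolding code_length_def code_drop_encode
    using length_le_list_encode[of xs] by (intro Least_equality) auto
qed

lemma computable_code_hd: "computable f \<Longrightarrow> computable (\<lambda>x. code_hd (f x))"
  and computable_code_tl: "computable f \<Longrightarrow> computable (\<lambda>x. code_tl (f x))"
  unfolding code_hd_def code_tl_def by (intro computable_rules, assumption)+

lemma computable_code_drop:
  "computable f \<Longrightarrow> computable g \<Longrightarrow> computable (\<lambda>x. code_drop (f x) (g x))"
  unfolding code_drop_def by (intro computable_rules computable_code_tl)

lemma computable_code_nth:
  "computable f \<Longrightarrow> computable g \<Longrightarrow> computable (\<lambda>x. code_nth (f x) (g x))"
  unfolding code_nth_def by (intro computable_code_hd computable_code_drop)

lemma computable_code_length:
  assumes "computable f" shows "computable (\<lambda>x. code_length (f x))"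
  unfolding code_length_def
  by (intro computable_rules computable_code_drop computable_compose[OF assms] assms)

text \<open>
  A list code is built from the tail, whereas recursion on the length counts upwards; hence
  the reversed index.
\<close>

lemma list_encode_map_upt:
  "list_encode (map f [0..<n]) = rec_nat 0 (\<lambda>m y. Suc (prod_encode (f (n - 1 - m), y))) n"
proof -
  have "m \<le> n \<Longrightarrow> list_encode (map f [n - m..<n]) =
      rec_nat 0 (\<lambda>m y. Suc (prod_encode (f (n - 1 - m), y))) m" for m
  proof (induction m)
    case (Suc m)
    have eq: "[n - Suc m..<n] = (n - Suc m) # [n - m..<n]"
      using Suc.prems by (subst upt_conv_Cons) (auto simp: Suc_diff_Suc)
    show ?case using Suc unfolding eq by simp
  qed simp
  from this[of n] show ?thesis by simp
qed

lemma computable_map_upt: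
  assumes f: "computable (\<lambda>z. f (pfst z) (psnd z))" and n: "computable n"
  shows "computable (\<lambda>x. list_encode (map (f x) [0..<n x]))"
proof -
  have "computable (\<lambda>z. f (pfst z) (n (pfst z) - 1 - pfst (psnd z)))"
    by (intro computable_compose2[OF f] computable_rules computable_compose[OF n])
  then show ?thesis unfolding list_encode_map_upt by (intro computable_rules n)
qed

lemmas computable_list_rules = computable_rules computable_code_hd computable_code_tl
  computable_code_nth computable_code_length computable_map_upt

section \<open>A universal program\<close>

text \<open>
  A configuration of the machine is a quadruple. The first component \<open>0\<close> means that the program with
  number \<open>a\<close> is to be evaluated at \<open>b\<close>, the first component \<open>1\<close> that the value \<open>a\<close> is to be returned to
  the top frame of the stack \<open>c\<close>. Frames are quadruples as well; their first component selects what to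
  do with the returned value.
\<close>

definition conf :: "nat \<Rightarrow> nat \<Rightarrow> nat \<Rightarrow> nat \<Rightarrow> nat" where
  "conf m a b c = prod_encode (m, prod_encode (a, prod_encode (b, c)))"
definition conf1 :: "nat \<Rightarrow> nat" where "conf1 z = pfst z"
definition conf2 :: "nat \<Rightarrow> nat" where "conf2 z = pfst (psnd z)"
definition conf3 :: "nat \<Rightarrow> nat" where "conf3 z = pfst (psnd (psnd z))"
definition conf4 :: "nat \<Rightarrow> nat" where "conf4 z = psnd (psnd (psnd z))"
definition push :: "nat \<Rightarrow> nat \<Rightarrow> nat" where "push F K = Suc (prod_encode (F, K))"

lemma conf_sel [simp]: "conf1 (conf m a b c) = m" "conf2 (conf m a b c) = a"
  "conf3 (conf m a b c) = b" "conf4 (conf m a b c) = c"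
  by (simp_all add: conf_def conf1_def conf2_def conf3_def conf4_def)

lemma push_sel [simp]: "code_hd (push F K) = F" "code_tl (push F K) = K" "push F K \<noteq> 0" "0 < push F K"
  by (simp_all add: push_def code_hd_def code_tl_def)

definition eval_step :: "nat \<Rightarrow> nat \<Rightarrow> nat \<Rightarrow> nat" where
  "eval_step e x K =
    (if e = 0 then conf 1 0 0 K
     else if e = 1 then conf 1 (Suc x) 0 K
     else if e = 2 then conf 1 (pfst x) 0 K
     else if e = 3 then conf 1 (psnd x) 0 K
     else
       let m = (e - 4) div 4; f = pfst m; g = psnd m; t = (e - 4) mod 4
       in if t = 0 then conf 0 f x (push (conf 0 g x 0) K)
          else if t = 1 then conf 0 g x (push (conf 2 f 0 0) K)
          else if t = 2 then
            (if psnd x = 0 then conf 0 f (pfst x) K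
             else conf 0 e (prod_encode (pfst x, psnd x - 1))
               (push (conf 3 g (pfst x) (psnd x - 1)) K))
          else conf 0 m (prod_encode (x, 0)) (push (conf 4 m x 0) K))"

text \<open>
  Frame \<open>0\<close> awaits the first component of a pair and frame \<open>1\<close> the second; frame \<open>2\<close> awaits the inner
  value of a composition; frame \<open>3\<close> awaits the previous value of a recursion; frame \<open>4\<close> awaits the value
  tested by an unbounded search at stage \<open>c\<close>. On the empty stack the configuration stays as it is.
\<close>

definition return_step :: "nat \<Rightarrow> nat \<Rightarrow> nat" where
  "return_step v K =
    (if K = 0 then conf 1 v 0 0
     else
       let F = code_hd K; L = code_tl K; t = conf1 F; a = conf2 F; b = conf3 F; c = conf4 F
       in if t = 0 then conf 0 a b (push (conf 1 v 0 0) L)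
          else if t = 1 then conf 1 (prod_encode (a, v)) 0 L
          else if t = 2 then conf 0 a v L
          else if t = 3 then conf 0 a (prod_encode (b, prod_encode (c, v))) L
          else if v = 0 then conf 1 c 0 L
          else conf 0 a (prod_encode (b, Suc c)) (push (conf 4 a b (Suc c)) L))"

definition machine_step :: "nat \<Rightarrow> nat" where
  "machine_step z =
    (if conf1 z = 0 then eval_step (conf2 z) (conf3 z) (conf4 z)
     else return_step (conf2 z) (conf4 z))"

lemma machine_step_simps [simp]:
  "machine_step (conf 0 e x K) = eval_step e x K"
  "machine_step (conf 1 v b K) = return_step v K"
  by (simp_all add: machine_step_def)

lemma computable_machine_step: "computable machine_step"
  unfolding machine_step_def eval_step_def return_step_def Let_def conf_def push_def
    conf1_def conf2_def conf3_def conf4_def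
  by (intro computable_list_rules zero_less_numeral)

definition reaches :: "nat \<Rightarrow> nat \<Rightarrow> bool" where
  "reaches c d \<longleftrightarrow> (\<exists>t. (machine_step ^^ t) c = d)"

lemma reaches_refl: "reaches c c"
  unfolding reaches_def by (rule exI[of _ 0]) simp

lemma reaches_trans:
  assumes "reaches c d" "reaches d e" shows "reaches c e"
proof -
  obtain s t where "(machine_step ^^ s) c = d" "(machine_step ^^ t) d = e"
    using assms by (auto simp: reaches_def)
  then have "(machine_step ^^ (t + s)) c = e" by (simp add: funpow_add)
  then show ?thesis by (auto simp: reaches_def)
qed

lemma reaches_step:
  assumes "reaches (machine_step c) d" shows "reaches c d"
proof -
  obtain t where "(machine_step ^^ t) (machine_step c) = d" using assms by (auto simp: reaches_def)
  then have "(machine_step ^^ Suc t) c = d" by (simp add: funpow_swap1)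
  then show ?thesis unfolding reaches_def by blast
qed

lemma decode_prog_cases:
  "decode_prog e = PZero \<Longrightarrow> e = 0"
  "decode_prog e = PSucc \<Longrightarrow> e = 1"
  "decode_prog e = PFst \<Longrightarrow> e = 2"
  "decode_prog e = PSnd \<Longrightarrow> e = 3"
  "decode_prog e = PPair f g \<Longrightarrow> 4 \<le> e \<and> (e - 4) mod 4 = 0 \<and>
     decode_prog (pfst ((e - 4) div 4)) = f \<and> decode_prog (psnd ((e - 4) div 4)) = g"
  "decode_prog e = PComp f g \<Longrightarrow> 4 \<le> e \<and> (e - 4) mod 4 = 1 \<and>
     decode_prog (pfst ((e - 4) div 4)) = f \<and> decode_prog (psnd ((e - 4) div 4)) = g"
  "decode_prog e = PRec f g \<Longrightarrow> 4 \<le> e \<and> (e - 4) mod 4 = 2 \<and>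
     decode_prog (pfst ((e - 4) div 4)) = f \<and> decode_prog (psnd ((e - 4) div 4)) = g"
  "decode_prog e = PMu f \<Longrightarrow> 4 \<le> e \<and> (e - 4) mod 4 = 3 \<and>
     decode_prog ((e - 4) div 4) = f"
  by (subst (asm) decode_prog.simps, simp add: Let_def split: if_splits; linarith)+

lemma run_PMu_SomeD:
  assumes "run (PMu f) a = Some n"
  shows "run f (prod_encode (a, n)) = Some 0"
    and "k < n \<Longrightarrow> \<exists>v. run f (prod_encode (a, k)) = Some v \<and> v \<noteq> 0"
proof -
  let ?P = "\<lambda>n. run f (prod_encode (a, n)) = Some 0 \<and>
    (\<forall>m<n. run f (prod_encode (a, m)) \<noteq> None)"
  have ex: "\<exists>n. ?P n" and n: "n = (LEAST n. ?P n)"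
    using assms by (auto simp: Let_def split: if_splits)
  have P: "?P n" using LeastI_ex[OF ex] unfolding n .
  then show "run f (prod_encode (a, n)) = Some 0" by simp
  assume k: "k < n"
  have "\<not> ?P k" using k unfolding n by (rule not_less_Least)
  with P k show "\<exists>v. run f (prod_encode (a, k)) = Some v \<and> v \<noteq> 0"
    by (metis less_trans option.exhaust)
qed

text \<open>
  Only convergent computations are simulated. This suffices because the universal program is only
  applied to indices of total functions, and it spares the analysis of divergent runs.
\<close>

lemma machine_simulates:
  assumes "run p x = Some y" "decode_prog e = p"
  shows "reaches (conf 0 e x K) (conf 1 y 0 K)"
  using assms
proof (induction p arbitrary: e x y K)
  case (PPair f g)
  from decode_prog_cases(5)[OF PPair.prems(2)]
  have e: "4 \<le> e" "(e - 4) mod 4 = 0" "decode_prog (pfst ((e - 4) div 4)) = f"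
    "decode_prog (psnd ((e - 4) div 4)) = g" by auto
  obtain u v where u: "run f x = Some u" and v: "run g x = Some v" and y: "y = prod_encode (u, v)"
    using PPair.prems(1) by (auto simp: bind_eq_Some_conv)
  show ?case
    apply (rule reaches_step)
    using e(1,2) apply (simp add: eval_step_def Let_def del: One_nat_def)
    apply (rule reaches_trans[OF PPair.IH(1)[OF u e(3)]])
    apply (rule reaches_step)
    apply (simp add: return_step_def Let_def del: One_nat_def)
    apply (rule reaches_trans[OF PPair.IH(2)[OF v e(4)]])
    apply (rule reaches_step)
    apply (simp add: return_step_def Let_def y reaches_refl del: One_nat_def)
    done
next
  case (PComp f g)
  from decode_prog_cases(6)[OF PComp.prems(2)]
  have e: "4 \<le> e" "(e - 4) mod 4 = 1" "decode_prog (pfst ((e - 4) div 4)) = f"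
    "decode_prog (psnd ((e - 4) div 4)) = g" by auto
  obtain u where u: "run g x = Some u" and v: "run f u = Some y"
    using PComp.prems(1) by (auto simp: bind_eq_Some_conv)
  show ?case
    apply (rule reaches_step)
    using e(1,2) apply (simp add: eval_step_def Let_def del: One_nat_def)
    apply (rule reaches_trans[OF PComp.IH(2)[OF u e(4)]])
    apply (rule reaches_step)
    apply (simp add: return_step_def Let_def del: One_nat_def)
    apply (rule PComp.IH(1)[OF v e(3)])
    done
next
  case (PRec f g)
  from decode_prog_cases(7)[OF PRec.prems(2)]
  have e: "4 \<le> e" "(e - 4) mod 4 = 2" "decode_prog (pfst ((e - 4) div 4)) = f"
    "decode_prog (psnd ((e - 4) div 4)) = g" by auto
  have "run (PRec f g) (prod_encode (a, n)) = Some y \<Longrightarrow>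
      reaches (conf 0 e (prod_encode (a, n)) K) (conf 1 y 0 K)" for a n y K
  proof (induction n arbitrary: y K)
    case 0
    then have "run f a = Some y" by simp
    from PRec.IH(1)[OF this e(3)] show ?case
      by (intro reaches_step[of "conf _ _ _ _"])
        (use e in \<open>simp add: eval_step_def Let_def del: One_nat_def\<close>)
  next
    case (Suc n)
    obtain u where u: "run (PRec f g) (prod_encode (a, n)) = Some u"
      and v: "run g (prod_encode (a, prod_encode (n, u))) = Some y"
      using Suc.prems by (auto simp: bind_eq_Some_conv)
    show ?case
      apply (rule reaches_step)
      using e(1,2) apply (simp add: eval_step_def Let_def del: One_nat_def)
      apply (rule reaches_trans[OF Suc.IH[OF u]])
      apply (rule reaches_step)
      apply (simp add: return_step_def Let_def del: One_nat_def)
      apply (rule PRec.IH(2)[OF v e(4)])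
      done
  qed
  from this[of "pfst x" "psnd x"] PRec.prems show ?case by simp
next
  case (PMu f)
  from decode_prog_cases(8)[OF PMu.prems(2)]
  have e: "4 \<le> e" "(e - 4) mod 4 = 3" "decode_prog ((e - 4) div 4) = f" by auto
  define m where "m = (e - 4) div 4"
  note D = run_PMu_SomeD[OF PMu.prems(1)]
  \<comment> \<open>downward induction on the stage of the search, starting from its result \<open>y\<close>\<close>
  have "reaches (conf 0 m (prod_encode (x, k)) (push (conf 4 m x k) K)) (conf 1 y 0 K)"
    if "k \<le> y" for k
    using that
  proof (induction rule: inc_induct)
    case base
    show ?case
      apply (rule reaches_trans[OF PMu.IH[OF D(1) e(3)[folded m_def]]])
      apply (rule reaches_step)
      apply (simp add: return_step_def Let_def reaches_refl del: One_nat_def)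
      done
  next
    case (step k)
    obtain v where v: "run f (prod_encode (x, k)) = Some v" "v \<noteq> 0" using D(2)[OF step(2)] by blast
    show ?case
      apply (rule reaches_trans[OF PMu.IH[OF v(1) e(3)[folded m_def]]])
      apply (rule reaches_step)
      using v(2) step.IH apply (simp add: return_step_def Let_def del: One_nat_def)
      done
  qed
  from this[of 0] show ?case
    by (intro reaches_step[of "conf _ _ _ _"])
      (use e in \<open>simp add: eval_step_def Let_def m_def del: One_nat_def\<close>)
qed (auto dest!: decode_prog_cases simp: eval_step_def Let_def simp del: One_nat_def
    intro!: reaches_step[of "conf 0 _ _ _"] reaches_refl)

text \<open>
  The number of machine steps up to the first halted configuration is found by unbounded
  search; a halted configuration is a fixed point, so the first one already shows the result.
\<close>

lemma universal_program:
  "\<exists>U. \<forall>e x y. phi e x = Some y \<longrightarrow> run U (prod_encode (e, x)) = Some y"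
proof -
  define trace where "trace z = (machine_step ^^ psnd z) (conf 0 (pfst (pfst z)) (psnd (pfst z)) 0)" for z
  have "trace = (\<lambda>z. rec_nat (conf 0 (pfst (pfst z)) (psnd (pfst z)) 0) (\<lambda>_. machine_step) (psnd z))"
  proof
    fix z
    have "(machine_step ^^ n) c = rec_nat c (\<lambda>_. machine_step) n" for n c by (induction n) auto
    then show "trace z = rec_nat (conf 0 (pfst (pfst z)) (psnd (pfst z)) 0) (\<lambda>_. machine_step) (psnd z)"
      by (simp add: trace_def)
  qed
  then have trace: "computable trace"
    by (simp only:) (unfold conf_def, intro computable_rules computable_compose[OF computable_machine_step])
  have "computable (\<lambda>z. if conf1 (trace z) = 1 \<and> conf4 (trace z) = 0 then 0 else 1)"
    "computable (\<lambda>z. conf2 (trace z))"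
    unfolding conf1_def conf2_def conf4_def
    by (intro computable_rules computable_compose[OF trace] trace)+
  then obtain H Q where
    H: "\<And>z. run H z = Some (if conf1 (trace z) = 1 \<and> conf4 (trace z) = 0 then 0 else 1)"
    and Q: "\<And>z. run Q z = Some (conf2 (trace z))"
    unfolding computable_iff_run by blast
  have "run (PComp Q (PPair (PPair PFst PSnd) (PMu H))) (prod_encode (e, x)) = Some y"
    if phi: "phi e x = Some y" for e x y
  proof -
    obtain t where t: "(machine_step ^^ t) (conf 0 e x 0) = conf 1 y 0 0"
      using machine_simulates[OF phi[unfolded phi_def] refl, of 0] by (auto simp: reaches_def)
    let ?T = "\<lambda>n. trace (prod_encode (prod_encode (e, x), n))"
    have T: "?T n = (machine_step ^^ n) (conf 0 e x 0)" for n by (simp add: trace_def)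
    have halted: "run H (prod_encode (prod_encode (e, x), n)) = Some 0 \<longleftrightarrow>
       conf1 (?T n) = 1 \<and> conf4 (?T n) = 0" for n by (simp add: H)
    have defd: "run H z \<noteq> None" for z by (simp add: H)
    have ex: "conf1 (?T t) = 1 \<and> conf4 (?T t) = 0" by (simp add: T t)
    define s where "s = (LEAST n. conf1 (?T n) = 1 \<and> conf4 (?T n) = 0)"
    have s: "conf1 (?T s) = 1 \<and> conf4 (?T s) = 0" unfolding s_def by (rule LeastI[where k = t]) (rule ex)
    have "s \<le> t" unfolding s_def by (rule Least_le) (rule ex)
    \<comment> \<open>a halted configuration returns the same value for ever\<close>
    have stay: "conf2 ((machine_step ^^ n) (?T s)) = conf2 (?T s) \<and>
       conf1 ((machine_step ^^ n) (?T s)) = 1 \<and> conf4 ((machine_step ^^ n) (?T s)) = 0" for n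
      by (induction n) (use s in \<open>auto simp: machine_step_def return_step_def Let_def\<close>)
    have "(machine_step ^^ (t - s)) (?T s) = ?T t"
      using \<open>s \<le> t\<close> by (simp add: T flip: funpow_add[THEN fun_cong, unfolded comp_apply])
    then have "conf2 (?T s) = y" using stay[of "t - s"] by (simp add: T t)
    moreover have "run (PMu H) (prod_encode (e, x)) = Some s"
      using ex unfolding s_def by (auto simp: halted defd Let_def)
    ultimately show ?thesis by (simp add: Q)
  qed
  then show ?thesis by blast
qed

section \<open>Completeness in an effective coding system\<close>

text \<open>
  A multivalued problem on codes: from every \<open>c\<close> with \<open>D c\<close>, a realizable function finds some \<open>q\<close> with
  \<open>G c q\<close>. All existence statements about realizable functions in the definitions of morphisms,
  inclusions and reductions take this form, and solvable problems compose without naming the functions.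
\<close>

definition solvable ::
  "'c coding_system \<Rightarrow> ('c \<Rightarrow> bool) \<Rightarrow> ('c \<Rightarrow> 'c \<Rightarrow> bool) \<Rightarrow> bool" where
  "solvable C D G \<longleftrightarrow> (\<exists>r\<in>realizable C. \<forall>c. D c \<longrightarrow> (\<exists>q. r c = Some q \<and> G c q))"

lemma solvable_mono:
  "solvable C D G \<Longrightarrow> (\<And>c. D' c \<Longrightarrow> D c) \<Longrightarrow> (\<And>c q. D' c \<Longrightarrow> G c q \<Longrightarrow> G' c q) \<Longrightarrow> solvable C D' G'"
  unfolding solvable_def by meson

lemma morphism_iff_solvable:
  "morphism C X Y f \<longleftrightarrow>
    solvable C (\<lambda>p. X p \<noteq> None) (\<lambda>p q. \<forall>x. X p = Some x \<longrightarrow> Y q = Some (f x))"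
proof
  assume "morphism C X Y f"
  then show "solvable C (\<lambda>p. X p \<noteq> None) (\<lambda>p q. \<forall>x. X p = Some x \<longrightarrow> Y q = Some (f x))"
    unfolding morphism_def solvable_def by (metis option.exhaust option.inject)
next
  assume "solvable C (\<lambda>p. X p \<noteq> None) (\<lambda>p q. \<forall>x. X p = Some x \<longrightarrow> Y q = Some (f x))"
  then obtain r where r: "r \<in> realizable C"
    and rx: "\<And>p x. X p = Some x \<Longrightarrow> \<exists>q. r p = Some q \<and> Y q = Some (f x)"
    unfolding solvable_def by fastforce
  have "f ` ran X \<subseteq> ran Y"
    using rx by (force simp: ran_def)
  with r rx show "morphism C X Y f" unfolding morphism_def by blast
qed

lemma morphismD:
  "morphism C X Y f \<Longrightarrow>
    solvable C (\<lambda>p. X p \<noteq> None) (\<lambda>p q. \<forall>x. X p = Some x \<longrightarrow> Y q = Some (f x))"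
  by (simp add: morphism_iff_solvable)

text \<open>
  What the completeness proof requires of a coding system. The morphism in \<open>morphism_excess\<close> combines
  evaluation with truncated subtraction: it vanishes iff \<open>x k \<le> n\<close>.
\<close>

locale effective_coding =
  fixes C :: "'c coding_system"
  assumes cunpair_cpair [simp]: "cunpair C (cpair C z) = z"
    and cpair_cunpair [simp]: "cpair C (cunpair C c) = c"
    and ran_omega: "ran (omega C) = UNIV"
    and solvable_id: "solvable C D (\<lambda>c q. q = c)"
    and solvable_comp: "\<lbrakk>solvable C D G; solvable C E H; \<And>c q. D c \<Longrightarrow> G c q \<Longrightarrow> E q\<rbrakk> \<Longrightarrow>
          solvable C D (\<lambda>c w. \<exists>q. G c q \<and> H q w)"
    and solvable_pair: "\<lbrakk>solvable C D G; solvable C D H\<rbrakk> \<Longrightarrow>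
          solvable C D (\<lambda>c w. \<exists>a b. w = cpair C (a, b) \<and> G c a \<and> H c b)"
    and solvable_fst: "solvable C D (\<lambda>c q. q = fst (cunpair C c))"
    and solvable_snd: "solvable C D (\<lambda>c q. q = snd (cunpair C c))"
    and morphism_excess:
      "morphism C (prod_space C (omega C) (prod_space C (baire C) (omega C))) (omega C)
        (\<lambda>(n, x, k). x k - n)"
    and morphism_curry:
      "morphism C (prod_space C (omega C) (prod_space C (baire C) (omega C))) (omega C) f \<Longrightarrow>
        morphism C (baire C) (baire C) (\<lambda>x j. f (pfst j, x, psnd j))"
    and morphism_prefix:
      "\<lbrakk>computable \<psi>; computable N\<rbrakk> \<Longrightarrow>
        morphism C (baire C) (baire C)
          (\<lambda>x s. \<psi> (prod_encode (s, list_encode (map x [0..<N s]))))"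

text \<open>
  The default value \<open>s\<close> makes the search finite; since it grows with the stage, it does not by itself
  keep the guesses bounded.
\<close>

definition guess :: "(nat \<times> 'a \<times> nat \<Rightarrow> nat) \<Rightarrow> 'a \<Rightarrow> nat \<Rightarrow> nat" where
  "guess f x s = (LEAST n. n = s \<or> (\<forall>k<s. f (n, x, k) = 0))"

lemma guess_le:
  assumes "\<forall>k. f (n, x, k) = 0" shows "guess f x s \<le> n"
  unfolding guess_def by (rule Least_le) (use assms in simp)

text \<open>
  Otherwise each of the finitely many candidates up to \<open>b\<close> is refuted at some stage, and a later guess
  exceeds \<open>b\<close>.
\<close>

lemma bounded_guess:
  assumes "\<And>s. guess f x s \<le> b" shows "\<exists>n\<le>b. \<forall>k. f (n, x, k) = 0"
proof (rule ccontr)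
  assume "\<not> ?thesis"
  then obtain k where k: "\<And>n. n \<le> b \<Longrightarrow> f (n, x, k n) \<noteq> 0" by metis
  \<comment> \<open>by this stage all candidates up to \<open>b\<close> are refuted, and the default value exceeds \<open>b\<close>\<close>
  define s where "s = Suc (b + Max (k ` {..b}))"
  have ks: "k n < s" if "n \<le> b" for n
  proof -
    have "k n \<le> Max (k ` {..b})" using that by (intro Max_ge) auto
    then show ?thesis by (simp add: s_def)
  qed
  have "guess f x s = s \<or> (\<forall>k<s. f (guess f x s, x, k) = 0)"
    unfolding guess_def by (rule LeastI[of _ s]) simp
  moreover have "guess f x s \<noteq> s" using assms[of s] by (auto simp: s_def)
  ultimately show False using k ks assms[of s] by blast
qed

lemma prod_encode_mono:
  assumes "a \<le> c" "b \<le> d" shows "prod_encode (a, b) \<le> prod_encode (c, d)"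
proof -
  have "triangle m \<le> triangle n" if "m \<le> n" for m n
    using that unfolding triangle_def by (intro div_le_mono mult_le_mono) simp_all
  with assms show ?thesis
    unfolding prod_encode_def by (simp add: add_mono)
qed

text \<open>
  The guess at stage \<open>s\<close> as a function of the pair of \<open>s\<close> and the code of a prefix of the table of \<open>f\<close>.
\<close>

definition guess_prefix :: "nat \<Rightarrow> nat" where
  "guess_prefix z = (LEAST n. n = pfst z \<or> (\<forall>k<pfst z. code_nth (psnd z) (prod_encode (n, k)) = 0))"

lemma computable_guess_prefix: "computable guess_prefix"
  unfolding guess_prefix_def by (intro computable_list_rules)

text \<open>
  At stage \<open>s\<close> only entries with arguments \<open>n \<le> s\<close> and \<open>k < s\<close> are inspected, and the Cantor pairing is
  monotone; so the prefix up to index \<open>\<langle>s, s\<rangle>\<close> contains them all.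
\<close>

lemma guess_eq_guess_prefix:
  "guess f x s = guess_prefix (prod_encode (s, list_encode
     (map (\<lambda>j. f (pfst j, x, psnd j)) [0..<Suc (prod_encode (s, s))])))"
  (is "_ = guess_prefix (prod_encode (s, list_encode (map ?F [0..<?N])))")
proof -
  let ?P = "\<lambda>n. n = s \<or> (\<forall>k<s. f (n, x, k) = 0)"
  let ?Q = "\<lambda>n. n = s \<or> (\<forall>k<s. code_nth (list_encode (map ?F [0..<?N])) (prod_encode (n, k)) = 0)"
  have PQ: "?P n \<longleftrightarrow> ?Q n" if "n \<le> s" for n
  proof -
    have "code_nth (list_encode (map ?F [0..<?N])) (prod_encode (n, k)) = f (n, x, k)" if "k < s" for k
    proof -
      have lt: "prod_encode (n, k) < ?N"
        using prod_encode_mono[of n s k s] \<open>n \<le> s\<close> that by simp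
      then show ?thesis by (subst code_nth_encode) (simp_all del: upt_Suc)
    qed
    then show ?thesis by simp
  qed
  have "(LEAST n. ?P n) = (LEAST n. ?Q n)"
  proof (rule order_antisym)
    have "?Q (LEAST n. ?Q n)" by (rule LeastI[of _ s]) simp
    moreover have "(LEAST n. ?Q n) \<le> s" by (rule Least_le) simp
    ultimately show "(LEAST n. ?P n) \<le> (LEAST n. ?Q n)" using PQ by (intro Least_le) blast
    have "?P (LEAST n. ?P n)" by (rule LeastI[of _ s]) simp
    moreover have "(LEAST n. ?P n) \<le> s" by (rule Least_le) simp
    ultimately show "(LEAST n. ?Q n) \<le> (LEAST n. ?P n)" using PQ by (intro Least_le) blast
  qed
  then show ?thesis by (simp add: guess_def guess_prefix_def del: upt_Suc)
qed

lemma BddSeq_eq_witnessed_union: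
  "BddSeq C = witnessed_union C (\<lambda>n. rep_subspace (baire C) {x. \<forall>k. x k - n = 0})"
  unfolding BddSeq_def witnessed_union_def rep_subspace_def by simp

lemma rep_subspace_Some_iff: "rep_subspace X S p = Some x \<longleftrightarrow> X p = Some x \<and> x \<in> S"
  by (auto simp: rep_subspace_def bind_eq_Some_conv)

lemma witnessed_union_Some_iff:
  "witnessed_union C B c = Some x \<longleftrightarrow>
    (\<exists>n. omega C (fst (cunpair C c)) = Some n \<and> B n (snd (cunpair C c)) = Some x)"
  by (auto simp: witnessed_union_def bind_eq_Some_conv split: prod.split)

lemma BddSeq_Some_iff:
  "BddSeq C c = Some x \<longleftrightarrow>
    (\<exists>b. omega C (fst (cunpair C c)) = Some b \<and> baire C (snd (cunpair C c)) = Some x \<and> (\<forall>n. x n \<le> b))"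
  unfolding BddSeq_eq_witnessed_union witnessed_union_Some_iff rep_subspace_Some_iff by simp

context effective_coding begin

lemma morphism_id: "morphism C X X (\<lambda>x. x)"
  unfolding morphism_iff_solvable by (rule solvable_mono[OF solvable_id]) auto

lemma sub_equiv_refl: "sub_equiv C A A"
  by (simp add: sub_equiv_def sub_le_def morphism_id)

lemma uniform_le_refl: "uniform_le C A A"
proof -
  have "\<exists>r\<in>realizable C. \<forall>c. r c = Some (snd (cunpair C c))"
    using solvable_snd[of "\<lambda>_. True"] by (auto simp: solvable_def)
  then show ?thesis unfolding uniform_le_def by (metis cunpair_cpair snd_conv)
qed

lemma uniform_leD:
  assumes "uniform_le C A B"
  shows "solvable C (\<lambda>c. \<exists>n x. omega C (fst (cunpair C c)) = Some n \<and> A n (snd (cunpair C c)) = Some x)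
    (\<lambda>c q. \<forall>n x. omega C (fst (cunpair C c)) = Some n \<and> A n (snd (cunpair C c)) = Some x \<longrightarrow> B n q = Some x)"
  (is "solvable C ?D ?G")
proof -
  obtain r where "r \<in> realizable C" and
    r: "\<And>n u p x. omega C u = Some n \<Longrightarrow> A n p = Some x \<Longrightarrow> \<exists>q. r (cpair C (u, p)) = Some q \<and> B n q = Some x"
    using assms unfolding uniform_le_def by blast
  have "\<exists>q. r c = Some q \<and> ?G c q" if "?D c" for c
    using that r[of "fst (cunpair C c)" _ "snd (cunpair C c)"] by fastforce
  with \<open>r \<in> realizable C\<close> show ?thesis unfolding solvable_def by blast
qed

lemma uniform_le_ran:
  assumes "uniform_le C A B" shows "ran (A n) \<subseteq> ran (B n)"
proof
  fix x assume "x \<in> ran (A n)"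
  then obtain p where "A n p = Some x" by (auto simp: ran_def)
  moreover obtain u where "omega C u = Some n" using ran_omega by (auto simp: ran_def)
  ultimately show "x \<in> ran (B n)"
    using assms unfolding uniform_le_def by (metis ranI)
qed

lemma increasing_witness_BddSeq: "increasing_witness C (BddSeq C)"
  unfolding increasing_witness_def
proof (intro exI conjI allI impI)
  let ?B = "\<lambda>n. rep_subspace (baire C) {x. \<forall>k. x k - n = 0}"
  show "sub_equiv C (BddSeq C) (witnessed_union C ?B)"
    by (simp add: BddSeq_eq_witnessed_union sub_equiv_refl)
  show "uniformly_Pi1 C ?B"
    unfolding uniformly_Pi1_def
  proof (intro conjI allI)
    fix n
    show "subobject C (?B n) (baire C)"
      unfolding subobject_def morphism_iff_solvable
      by (auto simp: ran_def rep_subspace_Some_iff intro!: solvable_mono[OF solvable_id])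
    have "uniform_equiv C ?B (\<lambda>n. rep_subspace (baire C)
        {x. \<forall>k. (\<lambda>(n, x, k). x k - n) (n, x, k) = 0})"
      by (simp add: uniform_equiv_def uniform_le_refl)
    with morphism_excess
    show "\<exists>f. morphism C (prod_space C (omega C) (prod_space C (baire C) (omega C))) (omega C) f \<and>
        uniform_equiv C ?B (\<lambda>n. rep_subspace (baire C) {x. \<forall>k. f (n, x, k) = 0})"
      by blast
  qed
  fix n m :: nat assume "n \<le> m"
  then show "ran (?B n) \<subseteq> ran (?B m)"
    by (fastforce simp: ran_def rep_subspace_Some_iff intro: order_trans)
qed

lemma Sigma2_BddSeq: "Sigma2 C (BddSeq C)"
proof -
  have "subobject C (BddSeq C) (baire C)"
    unfolding subobject_def morphism_iff_solvable
    by (auto simp: ran_def BddSeq_Some_iff intro!: solvable_mono[OF solvable_snd])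
  with increasing_witness_BddSeq show ?thesis
    unfolding Sigma2_def increasing_witness_def by blast
qed

text \<open>
  Currying turns a name of \<open>x\<close> into a name of the table \<open>\<langle>n, k\<rangle> \<mapsto> f (n, x, k)\<close>, and the guesses are a prefix
  operator applied to this table.
\<close>

lemma morphism_guess:
  assumes "morphism C (prod_space C (omega C) (prod_space C (baire C) (omega C))) (omega C) f"
  shows "morphism C (baire C) (baire C) (guess f)"
proof -
  let ?F = "\<lambda>x j. f (pfst j, x, psnd j)"
  have guess: "guess f x = (\<lambda>s. guess_prefix (prod_encode (s, list_encode
      (map (?F x) [0..<Suc (prod_encode (s, s))]))))" for x
    by (rule ext) (rule guess_eq_guess_prefix)
  have "computable (\<lambda>s. Suc (prod_encode (s, s)))" by (intro computable_rules)
  from solvable_comp[OF morphismD[OF morphism_curry[OF assms]]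
      morphismD[OF morphism_prefix[OF computable_guess_prefix this]]]
  have "solvable C (\<lambda>p. baire C p \<noteq> None)
    (\<lambda>p w. \<exists>q. (\<forall>x. baire C p = Some x \<longrightarrow> baire C q = Some (?F x)) \<and>
      (\<forall>y. baire C q = Some y \<longrightarrow> baire C w = Some (\<lambda>s. guess_prefix
         (prod_encode (s, list_encode (map y [0..<Suc (prod_encode (s, s))]))))))"
    by fastforce
  then show ?thesis
    unfolding morphism_iff_solvable
  proof (rule solvable_mono)
    fix p w
    assume "\<exists>q. (\<forall>x. baire C p = Some x \<longrightarrow> baire C q = Some (?F x)) \<and>
      (\<forall>y. baire C q = Some y \<longrightarrow> baire C w = Some (\<lambda>s. guess_prefix
         (prod_encode (s, list_encode (map y [0..<Suc (prod_encode (s, s))])))))"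
    then show "\<forall>x. baire C p = Some x \<longrightarrow> baire C w = Some (guess f x)"
      unfolding guess by blast
  qed auto
qed

text \<open>
  The names are translated through the given witnessed union: forwards, its witness becomes the bound;
  backwards, the bound becomes the witness, and the uniform equivalence with the closed sets turns the
  name of \<open>x\<close> into a name in the member of the union with that index.
\<close>

lemma increasing_witness_reduces:
  assumes "increasing_witness C A"
  shows "many_one C A (baire C) (BddSeq C) (baire C)"
proof -
  obtain B f where
    AW: "sub_le C A (witnessed_union C B)" and WA: "sub_le C (witnessed_union C B) A"
    and mono: "\<And>n m. n \<le> m \<Longrightarrow> ran (B n) \<subseteq> ran (B m)"
    and f: "morphism C (prod_space C (omega C) (prod_space C (baire C) (omega C))) (omega C) f"
    and BR: "uniform_le C B (\<lambda>n. rep_subspace (baire C) {x. \<forall>k. f (n, x, k) = 0})"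
    and RB: "uniform_le C (\<lambda>n. rep_subspace (baire C) {x. \<forall>k. f (n, x, k) = 0}) B"
    using assms unfolding increasing_witness_def uniformly_Pi1_def sub_equiv_def uniform_equiv_def
    by blast
  note guess = morphism_guess[OF f]
  have ran_B: "ran (B n) = ran (baire C) \<inter> {x. \<forall>k. f (n, x, k) = 0}" for n
    using uniform_le_ran[OF BR, of n] uniform_le_ran[OF RB, of n]
    by (auto simp: ran_def rep_subspace_Some_iff)
  have bounded: "x \<in> ran (B b)" if "x \<in> ran (baire C)" "\<And>s. guess f x s \<le> b" for x b
    using bounded_guess[of f x b, OF that(2)] that(1) mono[of _ b] unfolding ran_B by blast
  have ran_W: "x \<in> ran (witnessed_union C B) \<longleftrightarrow> (\<exists>n. x \<in> ran (B n))" for x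
  proof
    assume "\<exists>n. x \<in> ran (B n)"
    then obtain n p where "B n p = Some x" by (auto simp: ran_def)
    moreover obtain u where "omega C u = Some n" using ran_omega by (auto simp: ran_def)
    ultimately have "witnessed_union C B (cpair C (u, p)) = Some x"
      by (simp add: witnessed_union_Some_iff)
    then show "x \<in> ran (witnessed_union C B)" by (rule ranI)
  qed (auto simp: ran_def witnessed_union_Some_iff)
  have ran_A: "x \<in> ran A \<longleftrightarrow> (\<exists>n. x \<in> ran (B n))" for x
    using AW WA unfolding sub_le_def ran_W[symmetric] by blast
  \<comment> \<open>the witness itself bounds the sequence of guesses\<close>
  have forward: "solvable C (\<lambda>p. A p \<noteq> None)
      (\<lambda>p q. \<forall>x. A p = Some x \<longrightarrow> BddSeq C q = Some (guess f x))"
  proof -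
    let ?D = "\<lambda>c. \<exists>n x. omega C (fst (cunpair C c)) = Some n \<and> B n (snd (cunpair C c)) = Some x"
    have "solvable C ?D
        (\<lambda>c w. \<forall>n x. omega C (fst (cunpair C c)) = Some n \<and> B n (snd (cunpair C c)) = Some x \<longrightarrow>
           baire C w = Some (guess f x))"
      by (rule solvable_mono[OF solvable_comp[OF uniform_leD[OF BR] morphismD[OF guess]]])
        (fastforce simp: rep_subspace_Some_iff)+
    from solvable_pair[OF solvable_fst this]
    have W: "solvable C ?D (\<lambda>c w. \<forall>x. witnessed_union C B c = Some x \<longrightarrow> BddSeq C w = Some (guess f x))"
    proof (rule solvable_mono)
      fix c w
      assume *: "\<exists>a b. w = cpair C (a, b) \<and> a = fst (cunpair C c) \<and>
        (\<forall>n x. omega C (fst (cunpair C c)) = Some n \<and> B n (snd (cunpair C c)) = Some x \<longrightarrow>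
           baire C b = Some (guess f x))"
      show "\<forall>x. witnessed_union C B c = Some x \<longrightarrow> BddSeq C w = Some (guess f x)"
      proof (intro allI impI)
        fix x assume "witnessed_union C B c = Some x"
        then obtain n where n: "omega C (fst (cunpair C c)) = Some n" "B n (snd (cunpair C c)) = Some x"
          by (auto simp: witnessed_union_Some_iff)
        have "x \<in> ran (B n)" using n(2) by (rule ranI)
        then have "guess f x s \<le> n" for s by (intro guess_le) (simp add: ran_B)
        with * n show "BddSeq C w = Some (guess f x)" by (auto simp: BddSeq_Some_iff)
      qed
    qed
    show ?thesis
      by (rule solvable_mono[OF solvable_comp[OF
              AW[unfolded sub_le_def, THEN conjunct2, THEN morphismD] W]])
        (fastforce simp: witnessed_union_Some_iff)+
  qed
  \<comment> \<open>a bound of the guesses is itself a witness because the witnesses are increasing\<close>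
  have backward: "solvable C
      (\<lambda>c. \<exists>x. baire C (fst (cunpair C c)) = Some x \<and> x \<in> ran A \<and>
         BddSeq C (snd (cunpair C c)) = Some (guess f x))
      (\<lambda>c p'. \<forall>x. baire C (fst (cunpair C c)) = Some x \<longrightarrow> A p' = Some x)"
    (is "solvable C ?D ?G")
  proof -
    have u: "solvable C ?D (\<lambda>c u. u = fst (cunpair C (snd (cunpair C c))))"
      by (rule solvable_mono[OF solvable_comp[OF solvable_snd solvable_fst]]) auto
    from solvable_pair[OF u solvable_fst]
    have swap: "solvable C ?D (\<lambda>c w. w = cpair C (fst (cunpair C (snd (cunpair C c))), fst (cunpair C c)))"
      by (rule solvable_mono) auto
    have B: "x \<in> ran (B b)"
      if "baire C p = Some x" "omega C u = Some b" "BddSeq C (cpair C (u, w)) = Some (guess f x)"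
      for p x u b w
      by (rule bounded) (use that in \<open>auto simp: BddSeq_Some_iff ran_def\<close>)
    have "solvable C ?D (\<lambda>c p'. \<forall>x b. baire C (fst (cunpair C c)) = Some x \<and>
        omega C (fst (cunpair C (snd (cunpair C c)))) = Some b \<longrightarrow> B b p' = Some x)"
    proof (rule solvable_mono[OF solvable_comp[OF swap uniform_leD[OF RB]]])
      fix c q
      assume "?D c" and q: "q = cpair C (fst (cunpair C (snd (cunpair C c))), fst (cunpair C c))"
      then obtain x b where "baire C (fst (cunpair C c)) = Some x"
        "BddSeq C (snd (cunpair C c)) = Some (guess f x)"
        "omega C (fst (cunpair C (snd (cunpair C c)))) = Some b"
        by (auto simp: BddSeq_Some_iff)
      moreover from this have "x \<in> ran (B b)"
        using B[of _ x _ b "snd (cunpair C (snd (cunpair C c)))"] by simp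
      ultimately show "\<exists>n x. omega C (fst (cunpair C q)) = Some n \<and>
          rep_subspace (baire C) {x. \<forall>k. f (n, x, k) = 0} (snd (cunpair C q)) = Some x"
        by (simp add: q rep_subspace_Some_iff ran_B)
    next
      fix c p'
      assume "?D c" and *: "\<exists>q. q = cpair C (fst (cunpair C (snd (cunpair C c))), fst (cunpair C c)) \<and>
        (\<forall>n x. omega C (fst (cunpair C q)) = Some n \<and>
          rep_subspace (baire C) {x. \<forall>k. f (n, x, k) = 0} (snd (cunpair C q)) = Some x \<longrightarrow>
          B n p' = Some x)"
      then obtain x b where x: "baire C (fst (cunpair C c)) = Some x"
        "BddSeq C (snd (cunpair C c)) = Some (guess f x)"
        "omega C (fst (cunpair C (snd (cunpair C c)))) = Some b"
        by (auto simp: BddSeq_Some_iff)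
      then have "x \<in> ran (B b)"
        using B[of _ x _ b "snd (cunpair C (snd (cunpair C c)))"] by simp
      with x * show "\<forall>x b. baire C (fst (cunpair C c)) = Some x \<and>
          omega C (fst (cunpair C (snd (cunpair C c)))) = Some b \<longrightarrow> B b p' = Some x"
        by (auto simp: rep_subspace_Some_iff ran_B)
    qed auto
    from solvable_pair[OF u this]
    have W: "solvable C ?D (\<lambda>c w. \<forall>x. baire C (fst (cunpair C c)) = Some x \<longrightarrow>
        witnessed_union C B w = Some x)"
      by (rule solvable_mono) (auto simp: witnessed_union_Some_iff BddSeq_Some_iff)
    show ?thesis
      by (rule solvable_mono[OF solvable_comp[OF W
              WA[unfolded sub_le_def, THEN conjunct2, THEN morphismD]]]) fastforce+
  qed
  show ?thesis
    unfolding many_one_def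
  proof (intro exI[of _ "guess f"] conjI ballI)
    show "morphism C (baire C) (baire C) (guess f)" by (rule guess)
    obtain r where r: "r \<in> realizable C"
      and rp: "\<forall>p. A p \<noteq> None \<longrightarrow> (\<exists>q. r p = Some q \<and> (\<forall>x. A p = Some x \<longrightarrow> BddSeq C q = Some (guess f x)))"
      using forward unfolding solvable_def by blast
    then have r': "\<forall>p x. A p = Some x \<longrightarrow> (\<exists>q. r p = Some q \<and> BddSeq C q = Some (guess f x))"
      by fastforce
    with r show "\<exists>r\<in>realizable C. \<forall>p x. A p = Some x \<longrightarrow> (\<exists>q. r p = Some q \<and> BddSeq C q = Some (guess f x))"
      by blast
    show "x \<in> ran A \<longleftrightarrow> guess f x \<in> ran (BddSeq C)" if "x \<in> ran (baire C)" for x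
    proof
      assume "x \<in> ran A"
      then obtain p where "A p = Some x" by (auto simp: ran_def)
      with r' show "guess f x \<in> ran (BddSeq C)" by (metis ranI)
    next
      assume "guess f x \<in> ran (BddSeq C)"
      then obtain b where "\<And>s. guess f x s \<le> b" by (auto simp: ran_def BddSeq_Some_iff)
      with bounded[OF that] show "x \<in> ran A" unfolding ran_A by blast
    qed
    obtain r where "r \<in> realizable C" and "\<forall>c. (\<exists>x. baire C (fst (cunpair C c)) = Some x \<and> x \<in> ran A \<and>
         BddSeq C (snd (cunpair C c)) = Some (guess f x)) \<longrightarrow>
        (\<exists>p'. r c = Some p' \<and> (\<forall>x. baire C (fst (cunpair C c)) = Some x \<longrightarrow> A p' = Some x))"
      using backward unfolding solvable_def by blast
    then have "\<forall>p q x. baire C p = Some x \<and> x \<in> ran A \<and> BddSeq C q = Some (guess f x) \<longrightarrow>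
        (\<exists>p'. r (cpair C (p, q)) = Some p' \<and> A p' = Some x)"
      by (metis cunpair_cpair fst_conv snd_conv)
    with \<open>r \<in> realizable C\<close> show "\<exists>r\<in>realizable C. \<forall>p q x. baire C p = Some x \<and> x \<in> ran A \<and> BddSeq C q = Some (guess f x) \<longrightarrow>
        (\<exists>p'. r (cpair C (p, q)) = Some p' \<and> A p' = Some x)"
      by blast
  qed
qed

theorem BddSeq_complete:
  "complete_for C (\<lambda>A. Sigma2 C A \<and> increasing_witness C A) (BddSeq C)"
  unfolding complete_for_def
  using Sigma2_BddSeq increasing_witness_BddSeq increasing_witness_reduces by blast

end

section \<open>The first Kleene algebra\<close>

text \<open>
  The program \<open>\<sigma> e\<close> pairs its argument with the constant \<open>e\<close> and runs \<open>h\<close>; the constant is a numeral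
  written out in successor programs, whose number is computed by recursion on \<open>e\<close>.
\<close>

lemma smn:
  "\<exists>\<sigma>. computable \<sigma> \<and> (\<forall>e s. phi (\<sigma> e) s = run h (prod_encode (e, s)))"
proof -
  define const_prog where "const_prog = rec_nat PZero (\<lambda>_ p. PComp PSucc p)"
  define \<sigma> where "\<sigma> e = encode_prog (PComp h (PPair (const_prog e) (PPair PFst PSnd)))" for e
  have run_const: "run (const_prog e) s = Some e" for e s
    by (induction e) (simp_all add: const_prog_def)
  have "encode_prog (const_prog e) = rec_nat 0 (\<lambda>_ y. 5 + 4 * prod_encode (1, y)) e" for e
    by (induction e) (simp_all add: const_prog_def)
  then have "computable (\<lambda>e. encode_prog (const_prog e))"
    by (simp only:) (intro computable_rules)
  then have "computable \<sigma>"
    unfolding \<sigma>_def encode_prog.simps by (intro computable_rules)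
  moreover have "phi (\<sigma> e) s = run h (prod_encode (e, s))" for e s
    unfolding \<sigma>_def phi_encode_prog by (simp add: run_const)
  ultimately show ?thesis by blast
qed

lemma run_in_range_phi: "run P \<in> range phi"
  by (metis phi_encode_prog rangeI)

lemma solvable_K1: "solvable K1 D G \<longleftrightarrow> (\<exists>P. \<forall>c. D c \<longrightarrow> (\<exists>q. run P c = Some q \<and> G c q))"
proof -
  have "range phi = range run" using run_in_range_phi by (auto simp: phi_def)
  then show ?thesis by (simp add: solvable_def K1_def)
qed

lemma baire_K1_iff: "baire K1 e = Some x \<longleftrightarrow> (\<forall>n. phi e n = Some (x n))"
proof
  assume "\<forall>n. phi e n = Some (x n)"
  then show "baire K1 e = Some x" by (simp add: K1_def)
qed (auto simp: K1_def split: if_splits)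

text \<open>
  By the s-m-n theorem, an operator on indices need only be computed pointwise.
\<close>

lemma morphism_baire_K1I:
  assumes "\<And>e x. baire K1 e = Some x \<Longrightarrow> \<forall>s. run h (prod_encode (e, s)) = Some (G x s)"
  shows "morphism K1 (baire K1) (baire K1) G"
proof -
  obtain \<sigma> where "computable \<sigma>" and \<sigma>: "\<And>e s. phi (\<sigma> e) s = run h (prod_encode (e, s))"
    using smn by blast
  then obtain P where P: "\<And>e. run P e = Some (\<sigma> e)" unfolding computable_iff_run by blast
  have "baire K1 (\<sigma> e) = Some (G x)" if "baire K1 e = Some x" for e x
    using assms[OF that] by (simp add: baire_K1_iff \<sigma>)
  with P show ?thesis
    unfolding morphism_iff_solvable solvable_K1 by (intro exI[of _ P]) auto
qed

lemma K1_simps: "cpair K1 = prod_encode" "cunpair K1 = prod_decode" "omega K1 = Some"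
  by (auto simp: K1_def)

lemma prod_space_K1:
  "prod_space K1 (omega K1) (prod_space K1 (baire K1) (omega K1)) c = Some (n, x, k) \<longleftrightarrow>
    (\<exists>e. c = prod_encode (n, prod_encode (e, k)) \<and> baire K1 e = Some x)"
proof -
  have "prod_decode z = (a, b) \<longleftrightarrow> z = prod_encode (a, b)" for z a b
    by (metis prod_decode_inverse prod_encode_inverse)
  then show ?thesis
    unfolding prod_space_def K1_simps
    by (auto simp: bind_eq_Some_conv split: prod.splits)
qed

text \<open>
  The entries come from the universal program, so the recursion is run inside a partial program
  instead of being obtained from the closure properties of total functions.
\<close>

lemma prefix_program:
  "\<exists>W. \<forall>e x l. baire K1 e = Some x \<longrightarrow>
     run W (prod_encode (e, l)) = Some (list_encode (map x [0..<l]))"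
proof -
  obtain U where U: "\<And>e x y. phi e x = Some y \<Longrightarrow> run U (prod_encode (e, x)) = Some y"
    using universal_program by blast
  have "computable (\<lambda>z. prod_encode (pfst (pfst z), psnd (pfst z) - 1 - pfst (psnd z)))"
    "computable (\<lambda>z. psnd (psnd z))" "computable (\<lambda>z. prod_encode (z, psnd z))"
    by (intro computable_rules)+
  then obtain I Y Z where
    I: "\<And>z. run I z = Some (prod_encode (pfst (pfst z), psnd (pfst z) - 1 - pfst (psnd z)))"
    and Y: "\<And>z. run Y z = Some (psnd (psnd z))"
    and Z: "\<And>z. run Z z = Some (prod_encode (z, psnd z))"
    unfolding computable_iff_run by blast
  define R where "R = PRec PZero (PComp PSucc (PPair (PComp U I) Y))"
  have "run (PComp R Z) (prod_encode (e, l)) = Some (list_encode (map x [0..<l]))"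
    if "baire K1 e = Some x" for e x l
  proof -
    have "run R (prod_encode (prod_encode (e, l), m)) =
        Some (rec_nat 0 (\<lambda>m y. Suc (prod_encode (x (l - 1 - m), y))) m)" for m
      by (induction m) (use that in \<open>simp_all add: R_def I Y baire_K1_iff U\<close>)
    then show ?thesis by (simp add: Z list_encode_map_upt)
  qed
  then show ?thesis by blast
qed

lemma effective_coding_K1: "effective_coding K1"
proof
  show "cunpair K1 (cpair K1 z) = z" "cpair K1 (cunpair K1 c) = c" for z c
    by (simp_all add: K1_def)
  show "ran (omega K1) = UNIV" by (auto simp: K1_def ran_def)
  show "solvable K1 D (\<lambda>c q. q = c)" for D
    unfolding solvable_K1 by (rule exI[of _ "PPair PFst PSnd"]) simp
  show "solvable K1 D (\<lambda>c q. q = fst (cunpair K1 c))" for D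
    unfolding solvable_K1 by (rule exI[of _ PFst]) (simp add: K1_simps)
  show "solvable K1 D (\<lambda>c q. q = snd (cunpair K1 c))" for D
    unfolding solvable_K1 by (rule exI[of _ PSnd]) (simp add: K1_simps)
  show "solvable K1 D (\<lambda>c w. \<exists>q. G c q \<and> H q w)"
    if G: "solvable K1 D G" and H: "solvable K1 E H" and E: "\<And>c q. D c \<Longrightarrow> G c q \<Longrightarrow> E q" for D G E H
  proof -
    obtain P Q where "\<forall>c. D c \<longrightarrow> (\<exists>q. run P c = Some q \<and> G c q)"
      "\<forall>c. E c \<longrightarrow> (\<exists>q. run Q c = Some q \<and> H c q)"
      using G H unfolding solvable_K1 by blast
    with E show ?thesis
      unfolding solvable_K1 by (intro exI[of _ "PComp Q P"]) fastforce
  qed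
  show "solvable K1 D (\<lambda>c w. \<exists>a b. w = cpair K1 (a, b) \<and> G c a \<and> H c b)"
    if G: "solvable K1 D G" and H: "solvable K1 D H" for D G H
  proof -
    obtain P Q where "\<forall>c. D c \<longrightarrow> (\<exists>q. run P c = Some q \<and> G c q)"
      "\<forall>c. D c \<longrightarrow> (\<exists>q. run Q c = Some q \<and> H c q)"
      using G H unfolding solvable_K1 by blast
    then show ?thesis
      unfolding solvable_K1 K1_simps by (intro exI[of _ "PPair P Q"]) fastforce
  qed
  show "morphism K1 (prod_space K1 (omega K1) (prod_space K1 (baire K1) (omega K1))) (omega K1)
        (\<lambda>(n, x, k). x k - n)"
  proof -
    obtain U where U: "\<And>e x y. phi e x = Some y \<Longrightarrow> run U (prod_encode (e, x)) = Some y"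
      using universal_program by blast
    have "computable (\<lambda>z. psnd z - pfst z)" by (intro computable_rules)
    then obtain M where M: "\<And>z. run M z = Some (psnd z - pfst z)"
      unfolding computable_iff_run by blast
    have "run (PComp M (PPair PFst (PComp U PSnd))) (prod_encode (n, prod_encode (e, k))) = Some (x k - n)"
      if "baire K1 e = Some x" for n e k x
      using that by (simp add: baire_K1_iff M U)
    then show ?thesis
      unfolding morphism_iff_solvable solvable_K1
      by (intro exI[of _ "PComp M (PPair PFst (PComp U PSnd))"])
        (auto simp: prod_space_K1[unfolded K1_simps(3)] K1_simps(3) simp del: run.simps)
  qed
  show "morphism K1 (baire K1) (baire K1) (\<lambda>x j. f (pfst j, x, psnd j))"
    if f: "morphism K1 (prod_space K1 (omega K1) (prod_space K1 (baire K1) (omega K1))) (omega K1) f"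
    for f
  proof -
    obtain P where P: "\<And>n e k x. baire K1 e = Some x \<Longrightarrow>
        run P (prod_encode (n, prod_encode (e, k))) = Some (f (n, x, k))"
      using f unfolding morphism_iff_solvable solvable_K1
      by (fastforce simp: prod_space_K1[unfolded K1_simps(3)] K1_simps(3))
    show ?thesis
    proof (rule morphism_baire_K1I)
      show "\<forall>j. run (PComp P (PPair (PComp PFst PSnd) (PPair PFst (PComp PSnd PSnd)))) (prod_encode (e, j)) =
          Some (f (pfst j, x, psnd j))" if "baire K1 e = Some x" for e x
        by (simp add: P[OF that])
    qed
  qed
  show "morphism K1 (baire K1) (baire K1) (\<lambda>x s. \<psi> (prod_encode (s, list_encode (map x [0..<N s]))))"
    if \<psi>: "computable \<psi>" and N: "computable N" for \<psi> N
  proof -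
    obtain W where W: "\<And>e x l. baire K1 e = Some x \<Longrightarrow>
        run W (prod_encode (e, l)) = Some (list_encode (map x [0..<l]))"
      using prefix_program by blast
    obtain P Q where P: "\<And>z. run P z = Some (\<psi> z)" and Q: "\<And>z. run Q z = Some (N z)"
      using \<psi> N unfolding computable_iff_run by blast
    show ?thesis
    proof (rule morphism_baire_K1I)
      show "\<forall>s. run (PComp P (PPair PSnd (PComp W (PPair PFst (PComp Q PSnd))))) (prod_encode (e, s)) =
          Some (\<psi> (prod_encode (s, list_encode (map x [0..<N s]))))" if "baire K1 e = Some x" for e x
        by (simp add: W[OF that] P Q)
    qed
  qed
qed

section \<open>The second Kleene algebra\<close>

text \<open>
  Asking that every query which is answered at all be answered correctly makes it irrelevant which
  prefix is the first to be answered.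
\<close>

lemma kapp_eqI:
  assumes sound: "\<And>n k. p (list_encode (n # map x [0..<k])) \<in> {0, Suc (y n)}"
    and complete: "\<And>n. \<exists>k. p (list_encode (n # map x [0..<k])) \<noteq> 0"
  shows "kapp p x = Some y"
proof -
  have "kquery p x n (LEAST k. kquery p x n k \<noteq> 0) = Suc (y n)" for n
  proof -
    have "kquery p x n (LEAST k. kquery p x n k \<noteq> 0) \<noteq> 0"
      using complete[of n] unfolding kquery_def by (rule LeastI_ex)
    then show ?thesis using sound[of n "LEAST k. kquery p x n k \<noteq> 0"] unfolding kquery_def by simp
  qed
  with complete show ?thesis by (auto simp: kapp_def kquery_def)
qed

text \<open>
  The raw answers of an associate after the first nonzero one are arbitrary. Searching for the first
  answer among the prefixes of length at most \<open>b\<close> gives a value that depends only on \<open>b\<close> entries and,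
  where the application is defined, is \<open>0\<close> or correct for every \<open>b\<close> and nonzero for all large \<open>b\<close>.
\<close>

definition first_answer :: "(nat \<Rightarrow> nat) \<Rightarrow> nat \<Rightarrow> (nat \<Rightarrow> nat) \<Rightarrow> nat \<Rightarrow> nat" where
  "first_answer p n y b = kquery p y n (LEAST l. l = b \<or> kquery p y n l \<noteq> 0)"

lemma kquery_cong:
  assumes "\<And>i. i < k \<Longrightarrow> x i = y i" shows "kquery p x n k = kquery p y n k"
proof -
  have "map x [0..<k] = map y [0..<k]" using assms by simp
  then show ?thesis by (simp only: kquery_def)
qed

lemma first_answer_cong:
  assumes "\<And>i. i < b \<Longrightarrow> x i = y i" shows "first_answer p n x b = first_answer p n y b"
proof -
  have q: "kquery p x n l = kquery p y n l" if "l \<le> b" for l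
    using assms that by (intro kquery_cong) auto
  define L where "L z = (LEAST l. l = b \<or> kquery p z n l \<noteq> 0)" for z
  have L: "L z \<le> b" "L z = b \<or> kquery p z n (L z) \<noteq> 0"
     "\<And>l. l = b \<or> kquery p z n l \<noteq> 0 \<Longrightarrow> L z \<le> l" for z
    unfolding L_def by (rule Least_le, simp, rule LeastI[of _ b], simp, erule Least_le)
  have "L x = L y"
  proof (rule order_antisym)
    show "L x \<le> L y" using L(1,2)[of y] q by (intro L(3)) simp
    show "L y \<le> L x" using L(1,2)[of x] q by (intro L(3)) simp
  qed
  then show ?thesis
    using q[OF L(1)[of x]] unfolding first_answer_def L_def[symmetric] by simp
qed

lemma kapp_SomeD:
  assumes "kapp p x = Some z"
  shows "kquery p x n (LEAST k. kquery p x n k \<noteq> 0) = Suc (z n)"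
proof -
  have "\<exists>k. kquery p x n k \<noteq> 0" and z: "z n = kquery p x n (LEAST k. kquery p x n k \<noteq> 0) - 1"
    using assms by (auto simp: kapp_def split: if_splits)
  from LeastI_ex[OF this(1)] show ?thesis using z by simp
qed

lemma first_answer_sound:
  assumes "kapp p x = Some z" shows "first_answer p n x b \<in> {0, Suc (z n)}"
proof -
  define K where "K = (LEAST k. kquery p x n k \<noteq> 0)"
  have K: "kquery p x n K = Suc (z n)" "\<And>k. k < K \<Longrightarrow> kquery p x n k = 0"
    using kapp_SomeD[OF assms] not_less_Least unfolding K_def by blast+
  show ?thesis
  proof (cases "K \<le> b")
    case True
    then have "(LEAST l. l = b \<or> kquery p x n l \<noteq> 0) = K"
      using K by (intro Least_equality) (auto intro: leI)
    then show ?thesis by (simp add: first_answer_def K)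
  next
    case False
    then have "kquery p x n l = 0" if "l \<le> b" for l using that K(2) by auto
    moreover have "(LEAST l. l = b \<or> kquery p x n l \<noteq> 0) \<le> b" by (rule Least_le) simp
    ultimately show ?thesis by (simp add: first_answer_def)
  qed
qed

lemma first_answer_complete:
  assumes "kapp p x = Some z"
  shows "\<exists>B. \<forall>b\<ge>B. first_answer p n x b \<noteq> 0"
proof (intro exI allI impI)
  define K where "K = (LEAST k. kquery p x n k \<noteq> 0)"
  have K: "kquery p x n K \<noteq> 0" using kapp_SomeD[OF assms] by (simp add: K_def)
  fix b assume "K \<le> b"
  show "first_answer p n x b \<noteq> 0"
  proof -
    let ?L = "LEAST l. l = b \<or> kquery p x n l \<noteq> 0"
    have "?L = b \<or> kquery p x n ?L \<noteq> 0" by (rule LeastI[of _ b]) simp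
    moreover have "?L \<le> K" by (rule Least_le) (use K in simp)
    ultimately show ?thesis using K \<open>K \<le> b\<close> unfolding first_answer_def by (metis order_antisym)
  qed
qed

lemma computable_kquery:
  assumes p: "computable p" and y: "computable (\<lambda>z. y (pfst z) (psnd z))"
    and "computable n" "computable b"
  shows "computable (\<lambda>x. kquery p (y x) (n x) (b x))"
  unfolding kquery_def list_encode.simps
  by (intro computable_compose[OF p] computable_list_rules assms)

lemma computable_first_answer:
  assumes p: "computable p" and y: "computable (\<lambda>z. y (pfst z) (psnd z))"
    and n: "computable n" and b: "computable b"
  shows "computable (\<lambda>x. first_answer p (n x) (y x) (b x))"
  unfolding first_answer_def
  by (intro computable_kquery p computable_rules computable_compose2[OF y]
    computable_compose[OF n] n b y)

text \<open>
  The associate that answers query \<open>n\<close> on a prefix of length \<open>b\<close> by \<open>G n y b\<close>, where \<open>y\<close> agrees with the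
  given sequence below \<open>b\<close> and is arbitrary from there on.
\<close>

definition kcode :: "(nat \<Rightarrow> (nat \<Rightarrow> nat) \<Rightarrow> nat \<Rightarrow> nat) \<Rightarrow> nat \<Rightarrow> nat" where
  "kcode G c = G (code_hd c) (code_nth (code_tl c)) (code_length (code_tl c))"

lemma kapp_kcode:
  assumes cong: "\<And>n y y' b. (\<And>i. i < b \<Longrightarrow> y i = y' i) \<Longrightarrow> G n y b = G n y' b"
    and sound: "\<And>n b. G n x b \<in> {0, Suc (z n)}"
    and complete: "\<And>n. \<exists>b. G n x b \<noteq> 0"
  shows "kapp (kcode G) x = Some z"
proof -
  have "kcode G (list_encode (n # map x [0..<k])) = G n x k" for n k
    unfolding kcode_def code_hd_encode code_tl_encode code_length_encode length_map length_upt diff_zero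
    by (rule cong) simp
  with sound complete show ?thesis by (intro kapp_eqI) simp_all
qed

lemma kapp_kcode_total:
  assumes cong: "\<And>n y y' b. (\<And>i. i < b \<Longrightarrow> y i = y' i) \<Longrightarrow> G n y b = G n y' b"
    and "\<And>n. G n x (B n) \<noteq> 0"
    and "\<And>n b. G n x b \<noteq> 0 \<Longrightarrow> G n x b = Suc (z n)"
  shows "kapp (kcode G) x = Some z"
  by (rule kapp_kcode[OF cong]) (use assms(2,3) in \<open>blast+\<close>)

text \<open>
  The least \<open>i\<close> in this definition is the length, capped at \<open>b\<close>, of the initial segment of the
  intermediate sequence that is already determined by the given prefix.
\<close>

definition comp_code :: "(nat \<Rightarrow> nat) \<Rightarrow> (nat \<Rightarrow> nat) \<Rightarrow> nat \<Rightarrow> nat" where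
  "comp_code p q = kcode (\<lambda>n y b. first_answer p n (\<lambda>i. first_answer q i y b - 1)
     (LEAST i. i = b \<or> first_answer q i y b = 0))"

lemma kapp_comp_code:
  assumes q: "kapp q x = Some y" and p: "kapp p y = Some z"
  shows "kapp (comp_code p q) x = Some z"
  unfolding comp_code_def
proof (rule kapp_kcode)
  let ?b = "\<lambda>b. LEAST i. i = b \<or> first_answer q i x b = 0"
  have known: "first_answer q i x b - 1 = y i" if "i < ?b b" for i b
    using not_less_Least[OF that] first_answer_sound[OF q, of i b] by auto
  have eq: "first_answer p n (\<lambda>i. first_answer q i x b - 1) (?b b) = first_answer p n y (?b b)" for n b
    by (rule first_answer_cong) (rule known)
  show "first_answer p n (\<lambda>i. first_answer q i x b - 1) (?b b) \<in> {0, Suc (z n)}" for n b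
    unfolding eq by (rule first_answer_sound[OF p])
  fix n
  obtain B where B: "\<And>b. B \<le> b \<Longrightarrow> first_answer p n y b \<noteq> 0"
    using first_answer_complete[OF p] by blast
  obtain K where K: "\<And>i b. K i \<le> b \<Longrightarrow> first_answer q i x b \<noteq> 0"
    using first_answer_complete[OF q] by metis
  \<comment> \<open>long enough to determine the first \<open>B\<close> entries of the intermediate sequence\<close>
  define b where "b = B + Max (insert 0 (K ` {..<B}))"
  have "B \<le> ?b b"
  proof (rule ccontr)
    assume "\<not> B \<le> ?b b"
    then have lt: "?b b < B" by simp
    have "K (?b b) \<le> Max (insert 0 (K ` {..<B}))" using lt by (intro Max_ge) auto
    then have "first_answer q (?b b) x b \<noteq> 0" by (intro K) (simp add: b_def)
    moreover have "?b b = b \<or> first_answer q (?b b) x b = 0" by (rule LeastI[of _ b]) simp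
    ultimately show False using lt by (simp add: b_def)
  qed
  then show "\<exists>b. first_answer p n (\<lambda>i. first_answer q i x b - 1) (?b b) \<noteq> 0"
    unfolding eq using B by blast
next
  fix n b and y y' :: "nat \<Rightarrow> nat"
  assume "\<And>i. i < b \<Longrightarrow> y i = y' i"
  then have "first_answer q i y b = first_answer q i y' b" for i by (rule first_answer_cong)
  then show "first_answer p n (\<lambda>i. first_answer q i y b - 1) (LEAST i. i = b \<or> first_answer q i y b = 0) =
    first_answer p n (\<lambda>i. first_answer q i y' b - 1) (LEAST i. i = b \<or> first_answer q i y' b = 0)"
    by simp
qed

lemmas computable_kcode_rules = computable_list_rules computable_first_answer

lemma computable_comp_code: "computable p \<Longrightarrow> computable q \<Longrightarrow> computable (comp_code p q)"
  unfolding comp_code_def kcode_def by (intro computable_kcode_rules)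

definition pair_code :: "(nat \<Rightarrow> nat) \<Rightarrow> (nat \<Rightarrow> nat) \<Rightarrow> nat \<Rightarrow> nat" where
  "pair_code p q = kcode (\<lambda>n y b. if n mod 2 = 0 then first_answer p (n div 2) y b
     else first_answer q (n div 2) y b)"

lemma kapp_pair_code:
  assumes p: "kapp p x = Some y" and q: "kapp q x = Some z"
  shows "kapp (pair_code p q) x = Some (interleave (y, z))"
  unfolding pair_code_def
proof (rule kapp_kcode)
  show "(if n mod 2 = 0 then first_answer p (n div 2) x b else first_answer q (n div 2) x b)
    \<in> {0, Suc (interleave (y, z) n)}" for n b
    using first_answer_sound[OF p] first_answer_sound[OF q] by (simp add: interleave_def even_iff_mod_2_eq_zero)
  show "\<exists>b. (if n mod 2 = 0 then first_answer p (n div 2) x b else first_answer q (n div 2) x b) \<noteq> 0" for n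
    using first_answer_complete[OF p, of "n div 2"] first_answer_complete[OF q, of "n div 2"]
    by (metis order_refl)
qed (use first_answer_cong in metis)

lemma computable_pair_code: "computable p \<Longrightarrow> computable q \<Longrightarrow> computable (pair_code p q)"
  unfolding pair_code_def kcode_def by (intro computable_kcode_rules zero_less_numeral)

definition select_code :: "(nat \<Rightarrow> nat) \<Rightarrow> nat \<Rightarrow> nat" where
  "select_code h = kcode (\<lambda>n y b. if h n < b then Suc (y (h n)) else 0)"

lemma kapp_select_code: "kapp (select_code h) x = Some (\<lambda>n. x (h n))"
  unfolding select_code_def
  by (rule kapp_kcode_total[where B = "\<lambda>n. Suc (h n)"]) (simp_all split: if_splits)

lemma computable_select_code: "computable h \<Longrightarrow> computable (select_code h)"
  unfolding select_code_def kcode_def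
  by (intro computable_kcode_rules; erule computable_compose; intro computable_kcode_rules)

text \<open>
  The entries \<open>0\<close>, \<open>3\<close> and \<open>4 * k + 1\<close> of the name of \<open>(n, x, k)\<close> are \<open>n\<close>, \<open>k\<close> and \<open>x k\<close>;
  compare \<open>interleave_triple\<close>.
\<close>

definition excess_code :: "nat \<Rightarrow> nat" where
  "excess_code = kcode (\<lambda>i y b. if 0 < i then 1
     else if 3 < b then (if 4 * y 3 + 1 < b then Suc (y (4 * y 3 + 1) - y 0) else 0) else 0)"

lemma kapp_excess_code:
  "kapp excess_code x = Some (\<lambda>i. if i = 0 then x (4 * x 3 + 1) - x 0 else 0)"
  unfolding excess_code_def
  by (rule kapp_kcode_total[where B = "\<lambda>n. 4 * x 3 + 4"]) (simp_all split: if_splits)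

lemma computable_excess_code: "computable excess_code"
  unfolding excess_code_def kcode_def by (intro computable_kcode_rules)

definition prefix_code :: "(nat \<Rightarrow> nat) \<Rightarrow> (nat \<Rightarrow> nat) \<Rightarrow> nat \<Rightarrow> nat" where
  "prefix_code \<psi> N = kcode (\<lambda>s y b. if N s \<le> b
     then Suc (\<psi> (prod_encode (s, list_encode (map y [0..<N s])))) else 0)"

lemma kapp_prefix_code:
  "kapp (prefix_code \<psi> N) x = Some (\<lambda>s. \<psi> (prod_encode (s, list_encode (map x [0..<N s]))))"
  unfolding prefix_code_def
proof (rule kapp_kcode_total[where B = N])
  fix s b and y y' :: "nat \<Rightarrow> nat"
  assume y: "\<And>i. i < b \<Longrightarrow> y i = y' i"
  have "map y [0..<N s] = map y' [0..<N s]" if "N s \<le> b" using y that by simp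
  then show "(if N s \<le> b then Suc (\<psi> (prod_encode (s, list_encode (map y [0..<N s])))) else 0) =
     (if N s \<le> b then Suc (\<psi> (prod_encode (s, list_encode (map y' [0..<N s])))) else 0)"
    by presburger
qed (simp_all split: if_splits)

lemma computable_prefix_code:
  assumes "computable \<psi>" "computable N" shows "computable (prefix_code \<psi> N)"
  unfolding prefix_code_def kcode_def
  by (intro computable_kcode_rules computable_compose[OF assms(1)] computable_compose[OF assms(2)])

text \<open>
  The function passed to the associate \<open>r\<close> is the name of the triple of \<open>pfst j\<close>, \<open>y\<close> and \<open>psnd j\<close>. Its
  entry \<open>i\<close> involves \<open>y\<close> only at \<open>i div 4 \<le> i\<close>, so a prefix of \<open>y\<close> determines a prefix of the
  same length.
\<close>

definition curry_code :: "(nat \<Rightarrow> nat) \<Rightarrow> nat \<Rightarrow> nat" where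
  "curry_code r = kcode (\<lambda>j y b. first_answer r 0
     (\<lambda>i. if i mod 2 = 0 then (if i = 0 then pfst j else 0)
       else if i mod 4 = 1 then y (i div 4) else (if i = 3 then psnd j else 0)) b)"

text \<open>
  The name \<open>n0\<^sup>\<infinity>\<close> of a number \<open>n\<close>.
\<close>

definition unit_stream :: "nat \<Rightarrow> nat \<Rightarrow> nat" where
  "unit_stream n i = (if i = 0 then n else 0)"

lemma interleave_triple:
  "interleave (unit_stream n, interleave (x, unit_stream k)) =
    (\<lambda>i. if i mod 2 = 0 then (if i = 0 then n else 0)
       else if i mod 4 = 1 then x (i div 4) else (if i = 3 then k else 0))"
proof
  fix i :: nat
  obtain a t where i: "i = 4 * a + t" "t < 4"
    by (metis mult.commute div_mult_mod_eq mod_less_divisor zero_less_numeral)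
  have half: "4 * a div 2 = 2 * a" "(4 * a + 1) div 2 = 2 * a" "(4 * a + 2) div 2 = 2 * a + 1"
    "(4 * a + 3) div 2 = 2 * a + 1" "(2 * a + 1) div 2 = a"
    and quarter: "(4 * a + 1) div 4 = a" "(4 * a + 1) mod 4 = 1" "(4 * a + 3) mod 4 = 3"
    and parity: "4 * a mod 2 = 0" "(4 * a + 1) mod 2 = 1" "(4 * a + 2) mod 2 = 0" "(4 * a + 3) mod 2 = 1"
    by presburger+
  note arith = half quarter parity
  have "t = 0 \<or> t = 1 \<or> t = 2 \<or> t = 3" using i(2) by linarith
  then show "interleave (unit_stream n, interleave (x, unit_stream k)) i =
    (if i mod 2 = 0 then (if i = 0 then n else 0)
       else if i mod 4 = 1 then x (i div 4) else (if i = 3 then k else 0))"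
    by (elim disjE; simp only: i interleave_def unit_stream_def prod.case even_iff_mod_2_eq_zero arith
          add_0_right)
      auto
qed

lemma kapp_curry_code:
  assumes "\<And>j. \<exists>q. kapp r (interleave (unit_stream (pfst j), interleave (x, unit_stream (psnd j)))) = Some q \<and>
     q 0 = z j"
  shows "kapp (curry_code r) x = Some z"
  unfolding curry_code_def
proof (rule kapp_kcode)
  fix j
  obtain q where q: "kapp r (interleave (unit_stream (pfst j), interleave (x, unit_stream (psnd j)))) = Some q"
     and z: "z j = q 0" using assms[of j] by metis
  note q = q[unfolded interleave_triple]
  show "first_answer r 0
     (\<lambda>i. if i mod 2 = 0 then (if i = 0 then pfst j else 0)
       else if i mod 4 = 1 then x (i div 4) else (if i = 3 then psnd j else 0)) b \<in> {0, Suc (z j)}" for b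
    using first_answer_sound[OF q] by (simp add: z)
  show "\<exists>b. first_answer r 0
     (\<lambda>i. if i mod 2 = 0 then (if i = 0 then pfst j else 0)
       else if i mod 4 = 1 then x (i div 4) else (if i = 3 then psnd j else 0)) b \<noteq> 0"
    using first_answer_complete[OF q, of 0] by blast
qed (auto intro!: first_answer_cong)

lemma computable_curry_code: "computable r \<Longrightarrow> computable (curry_code r)"
  unfolding curry_code_def kcode_def by (intro computable_kcode_rules zero_less_numeral)

text \<open>
  Kleene's second algebra with the associates restricted to \<open>S\<close>, covering \<open>K2\<close> and \<open>KV\<close> at once.
\<close>

definition Kleene2 :: "(nat \<Rightarrow> nat) set \<Rightarrow> (nat \<Rightarrow> nat) coding_system" where
  "Kleene2 S = K2\<lparr>realizable := kapp ` S\<rparr>"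

lemma Kleene2_simps: "realizable (Kleene2 S) = kapp ` S" "cpair (Kleene2 S) = interleave"
  "cunpair (Kleene2 S) = deinterleave" "baire (Kleene2 S) = Some"
  "omega (Kleene2 S) u = (if \<forall>i>0. u i = 0 then Some (u 0) else None)"
  by (simp_all add: Kleene2_def K2_def)

lemma K2_eq_Kleene2: "K2 = Kleene2 UNIV" and KV_eq_Kleene2: "KV = Kleene2 {p. computable p}"
  by (simp_all add: Kleene2_def K2_def KV_def)

lemma omega_Kleene2: "omega (Kleene2 S) u = Some n \<longleftrightarrow> u = unit_stream n"
proof -
  have "omega (Kleene2 S) u = Some n \<longleftrightarrow> (\<forall>i>0. u i = 0) \<and> u 0 = n"
    by (simp add: Kleene2_simps(5))
  also have "\<dots> \<longleftrightarrow> (\<forall>i. u i = unit_stream n i)"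
    unfolding unit_stream_def by (metis neq0_conv)
  also have "\<dots> \<longleftrightarrow> u = unit_stream n"
    by (simp only: fun_eq_iff)
  finally show ?thesis .
qed

lemma solvable_Kleene2:
  "solvable (Kleene2 S) D G \<longleftrightarrow> (\<exists>r\<in>S. \<forall>c. D c \<longrightarrow> (\<exists>q. kapp r c = Some q \<and> G c q))"
  by (auto simp: solvable_def Kleene2_simps)

lemma prod_space_Kleene2:
  "prod_space (Kleene2 S) (omega (Kleene2 S)) (prod_space (Kleene2 S) (baire (Kleene2 S)) (omega (Kleene2 S))) c
     = Some (n, x, k) \<longleftrightarrow> c = interleave (unit_stream n, interleave (x, unit_stream k))"
proof -
  obtain u w where "deinterleave c = (u, w)" by fastforce
  then have c: "c = interleave (u, w)" using interleave_deinterleave[of c] by simp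
  obtain y v where "deinterleave w = (y, v)" by fastforce
  then have w: "w = interleave (y, v)" using interleave_deinterleave[of w] by simp
  have "inj interleave" by (rule inj_on_inverseI[of _ deinterleave]) (rule deinterleave_interleave)
  note inj = inj_eq[OF this]
  show ?thesis
    unfolding prod_space_def Kleene2_simps(3,4) c w deinterleave_interleave prod.case inj
    by (auto simp: bind_eq_Some_conv omega_Kleene2 inj)
qed

lemma effective_coding_Kleene2:
  assumes comp: "\<And>p q. p \<in> S \<Longrightarrow> q \<in> S \<Longrightarrow> comp_code p q \<in> S"
    and pair: "\<And>p q. p \<in> S \<Longrightarrow> q \<in> S \<Longrightarrow> pair_code p q \<in> S"
    and curry: "\<And>r. r \<in> S \<Longrightarrow> curry_code r \<in> S"
    and comput: "\<And>r. computable r \<Longrightarrow> r \<in> S"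
  shows "effective_coding (Kleene2 S)"
proof
  let ?K = "Kleene2 S"
  show "cunpair ?K (cpair ?K z) = z" "cpair ?K (cunpair ?K c) = c" for z c
    by (simp_all add: Kleene2_simps deinterleave_interleave interleave_deinterleave)
  show "ran (omega ?K) = UNIV" by (auto simp: ran_def omega_Kleene2)
  have select: "solvable ?K D (\<lambda>c q. q = (\<lambda>n. c (h n)))" if "computable h" for D h
    unfolding solvable_Kleene2
    by (rule bexI[of _ "select_code h"])
      (simp_all add: kapp_select_code comput computable_select_code that)
  show "solvable ?K D (\<lambda>c q. q = c)" for D
    using select[OF computable_id] by simp
  have "computable (\<lambda>n. 2 * n)" "computable (\<lambda>n. 2 * n + 1)" by (intro computable_rules)+
  from this[THEN select]
  show "solvable ?K D (\<lambda>c q. q = fst (cunpair ?K c))" "solvable ?K D (\<lambda>c q. q = snd (cunpair ?K c))" for D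
    by (simp_all add: Kleene2_simps deinterleave_def)
  show "solvable ?K D (\<lambda>c w. \<exists>q. G c q \<and> H q w)"
    if G: "solvable ?K D G" and H: "solvable ?K E H" and E: "\<And>c q. D c \<Longrightarrow> G c q \<Longrightarrow> E q" for D G E H
  proof -
    obtain p q where "p \<in> S" "q \<in> S" and p: "\<forall>c. D c \<longrightarrow> (\<exists>y. kapp p c = Some y \<and> G c y)"
      and q: "\<forall>c. E c \<longrightarrow> (\<exists>y. kapp q c = Some y \<and> H c y)"
      using G H unfolding solvable_Kleene2 by blast
    have "\<exists>z. kapp (comp_code q p) c = Some z \<and> (\<exists>y. G c y \<and> H y z)" if Dc: "D c" for c
    proof -
      obtain y where y: "kapp p c = Some y" "G c y" using p Dc by blast
      moreover obtain z where "kapp q y = Some z" "H y z" using q E[OF Dc y(2)] by blast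
      ultimately show ?thesis using kapp_comp_code by blast
    qed
    with comp[OF \<open>q \<in> S\<close> \<open>p \<in> S\<close>] show ?thesis unfolding solvable_Kleene2 by blast
  qed
  show "solvable ?K D (\<lambda>c w. \<exists>a b. w = cpair ?K (a, b) \<and> G c a \<and> H c b)"
    if G: "solvable ?K D G" and H: "solvable ?K D H" for D G H
  proof -
    obtain p q where "p \<in> S" "q \<in> S" and p: "\<forall>c. D c \<longrightarrow> (\<exists>y. kapp p c = Some y \<and> G c y)"
      and q: "\<forall>c. D c \<longrightarrow> (\<exists>y. kapp q c = Some y \<and> H c y)"
      using G H unfolding solvable_Kleene2 by blast
    have "\<exists>w. kapp (pair_code p q) c = Some w \<and> (\<exists>a b. w = cpair ?K (a, b) \<and> G c a \<and> H c b)"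
      if Dc: "D c" for c
    proof -
      obtain a b where "kapp p c = Some a" "G c a" "kapp q c = Some b" "H c b"
        using p q Dc by blast
      then show ?thesis
        by (intro exI[of _ "interleave (a, b)"]) (auto simp: Kleene2_simps(2) kapp_pair_code)
    qed
    with pair[OF \<open>p \<in> S\<close> \<open>q \<in> S\<close>] show ?thesis unfolding solvable_Kleene2 by blast
  qed
  show "morphism ?K (prod_space ?K (omega ?K) (prod_space ?K (baire ?K) (omega ?K))) (omega ?K)
        (\<lambda>(n, x, k). x k - n)"
  proof -
    have "kapp excess_code (interleave (unit_stream n, interleave (x, unit_stream k))) =
        Some (unit_stream (x k - n))" for n x k
      unfolding kapp_excess_code interleave_triple by (auto simp: unit_stream_def fun_eq_iff div_mod_4)
    then show ?thesis
      unfolding morphism_iff_solvable solvable_Kleene2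
      by (intro bexI[of _ excess_code] comput computable_excess_code)
        (auto simp: prod_space_Kleene2 omega_Kleene2, metis option.inject)
  qed
  show "morphism ?K (baire ?K) (baire ?K) (\<lambda>x j. f (pfst j, x, psnd j))"
    if f: "morphism ?K (prod_space ?K (omega ?K) (prod_space ?K (baire ?K) (omega ?K))) (omega ?K) f"
    for f
  proof -
    obtain r where "r \<in> S" and r: "\<And>n x k. kapp r (interleave (unit_stream n, interleave (x, unit_stream k))) =
        Some (unit_stream (f (n, x, k)))"
      using f unfolding morphism_iff_solvable solvable_Kleene2
      by (fastforce simp: prod_space_Kleene2 omega_Kleene2)
    have "kapp (curry_code r) x = Some (\<lambda>j. f (pfst j, x, psnd j))" for x
      by (rule kapp_curry_code) (simp add: r unit_stream_def)
    with curry[OF \<open>r \<in> S\<close>] show ?thesis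
      unfolding morphism_iff_solvable solvable_Kleene2 Kleene2_simps by auto
  qed
  show "morphism ?K (baire ?K) (baire ?K) (\<lambda>x s. \<psi> (prod_encode (s, list_encode (map x [0..<N s]))))"
    if "computable \<psi>" "computable N" for \<psi> N
    unfolding morphism_iff_solvable solvable_Kleene2 Kleene2_simps
    by (rule bexI[of _ "prefix_code \<psi> N"])
      (simp_all add: kapp_prefix_code comput computable_prefix_code that)
qed

section \<open>Completeness in the three coding systems\<close>

theorem theorem5p42:
  "complete_for K1 (\<lambda>A. Sigma2 K1 A \<and> increasing_witness K1 A) (BddSeq K1) \<and>
   complete_for K2 (\<lambda>A. Sigma2 K2 A \<and> increasing_witness K2 A) (BddSeq K2) \<and>
   complete_for KV (\<lambda>A. Sigma2 KV A \<and> increasing_witness KV A) (BddSeq KV)"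
proof (intro conjI)
  show "complete_for K1 (\<lambda>A. Sigma2 K1 A \<and> increasing_witness K1 A) (BddSeq K1)"
    by (rule effective_coding.BddSeq_complete[OF effective_coding_K1])
  have "effective_coding K2"
    unfolding K2_eq_Kleene2 by (rule effective_coding_Kleene2) simp_all
  then show "complete_for K2 (\<lambda>A. Sigma2 K2 A \<and> increasing_witness K2 A) (BddSeq K2)"
    by (rule effective_coding.BddSeq_complete)
  have "effective_coding KV"
    unfolding KV_eq_Kleene2
    by (rule effective_coding_Kleene2)
      (simp_all add: computable_comp_code computable_pair_code computable_curry_code)
  then show "complete_for KV (\<lambda>A. Sigma2 KV A \<and> increasing_witness KV A) (BddSeq KV)"
    by (rule effective_coding.BddSeq_complete)
qed

end
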